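(* Let $C$ be an infinite-dimensional chain coalgebra over a field $k$ and let $A=C^*$ be its dual algebra. Then there exists an element $t\in A$ such that every nonzero element of $A$ is of the form $at^n$ for some $n\ge 0$, where $a$ is an invertible element of $A$. In particular, $A$ is a left noetherian chain domain.
   Context: Coalgebras are coassociative and counital over $k$. $C^*=\mathrm{Hom}_k(C,k)$ is an algebra under the convolution product $(f*g)(x)=\sum f(x_i)g(x_i')$ for $\Delta(x)=\sum x_i\otimes x_i'$, with unit $\varepsilon$. A right coideal of $C$ is a right $C$-subcomodule of $C$. A chain coalgebra is a coalgebra whose right coideals are linearly ordered by inclusion (equivalently, whose left coideals are linearly ordered by inclusion). A left noetherian chain domain is a (not necessarily commutative) ring without zero divisors which is left noetherian and whose left ideals are linearly ordered by inclusion. *)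

theory Defs
  imports Complex_Main "HOL-Algebra.AbelCoset" "HOL-Library.Poly_Mapping"
begin

section \<open>Free vector spaces\<close>

text \<open>The free vector space over the field on a type of generators consists of the finitely
  supported functions.\<close>

definition free_scale :: "'k::field \<Rightarrow> ('x \<Rightarrow>\<^sub>0 'k) \<Rightarrow> ('x \<Rightarrow>\<^sub>0 'k)"
  where "free_scale c p = Poly_Mapping.map ((*) c) p"

definition gen :: "'x \<Rightarrow> ('x \<Rightarrow>\<^sub>0 'k::field)"
  where "gen x = Poly_Mapping.single x 1"

text \<open>The linear extension of \<open>h\<close> from the generators to the free vector space; \<open>s\<close> is the
  scalar multiplication of the target.\<close>

definition lin_ext :: "('k::field \<Rightarrow> 'v \<Rightarrow> 'v::ab_group_add) \<Rightarrow> ('x \<Rightarrow> 'v) \<Rightarrow> ('x \<Rightarrow>\<^sub>0 'k) \<Rightarrow> 'v"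
  where "lin_ext s h p = (\<Sum>x\<in>Poly_Mapping.keys p. s (Poly_Mapping.lookup p x) (h x))"

lemma lookup_free_scale: "Poly_Mapping.lookup (free_scale c p) x = c * Poly_Mapping.lookup p x"
  by (simp add: free_scale_def map.rep_eq when_def)

lemma vector_space_free_scale: "vector_space (free_scale :: 'k::field \<Rightarrow> ('x \<Rightarrow>\<^sub>0 'k) \<Rightarrow> _)"
  by unfold_locales
    (auto intro!: poly_mapping_eqI simp: lookup_free_scale lookup_add algebra_simps)

section \<open>Tensor products\<close>

text \<open>The vector space \<open>C\<close> is the type \<open>'c\<close> with scalar multiplication \<open>s\<close>.  The tensor powers
  \<open>C \<otimes> C\<close> and \<open>C \<otimes> C \<otimes> C\<close> are the quotients of the free vector spaces on pairs and triples by
  the bilinearity and trilinearity relations; their elements are represented as cosets.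
  In \<open>slot_rels s h\<close>, the function \<open>h\<close> inserts a vector into one slot of a pair or triple whose
  other entries are fixed.\<close>

definition slot_rels :: "('k::field \<Rightarrow> 'c::ab_group_add \<Rightarrow> 'c) \<Rightarrow> ('c \<Rightarrow> 'x) \<Rightarrow> ('x \<Rightarrow>\<^sub>0 'k) set"
  where "slot_rels s h =
    {gen (h (a + b)) - gen (h a) - gen (h b) | a b. True} \<union>
    {gen (h (s c a)) - free_scale c (gen (h a)) | c a. True}"

definition bilin_rels :: "('k::field \<Rightarrow> 'c::ab_group_add \<Rightarrow> 'c) \<Rightarrow> ('c \<times> 'c \<Rightarrow>\<^sub>0 'k) set"
  where "bilin_rels s = module.span free_scale
    (\<Union>y. slot_rels s (\<lambda>x. (x, y)) \<union> slot_rels s (\<lambda>x. (y, x)))"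

definition trilin_rels :: "('k::field \<Rightarrow> 'c::ab_group_add \<Rightarrow> 'c) \<Rightarrow> ('c \<times> 'c \<times> 'c \<Rightarrow>\<^sub>0 'k) set"
  where "trilin_rels s = module.span free_scale
    (\<Union>y z. slot_rels s (\<lambda>x. (x, y, z)) \<union> slot_rels s (\<lambda>x. (y, x, z)) \<union>
      slot_rels s (\<lambda>x. (y, z, x)))"

definition coset :: "('x \<Rightarrow>\<^sub>0 'k::field) set \<Rightarrow> ('x \<Rightarrow>\<^sub>0 'k) \<Rightarrow> ('x \<Rightarrow>\<^sub>0 'k) set"
  where "coset N p = {q. q - p \<in> N}"

definition tensor2 :: "('k::field \<Rightarrow> 'c::ab_group_add \<Rightarrow> 'c) \<Rightarrow> ('c \<times> 'c \<Rightarrow>\<^sub>0 'k) set set"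
  where "tensor2 s = range (coset (bilin_rels s))"

text \<open>A chosen representative of a coset, that is, an expression of a tensor as a formal linear
  combination of pure tensors.  Everything below is independent of this choice; for the
  convolution product see \<open>convolution_representative\<close>.\<close>

definition rep :: "('x \<Rightarrow>\<^sub>0 'k::field) set \<Rightarrow> ('x \<Rightarrow>\<^sub>0 'k)"
  where "rep t = (SOME p. p \<in> t)"

definition comult_left ::
    "('k::field \<Rightarrow> 'c::ab_group_add \<Rightarrow> 'c) \<Rightarrow> ('c \<Rightarrow> ('c \<times> 'c \<Rightarrow>\<^sub>0 'k) set) \<Rightarrow>
      ('c \<times> 'c \<Rightarrow>\<^sub>0 'k) set \<Rightarrow> ('c \<times> 'c \<times> 'c \<Rightarrow>\<^sub>0 'k) set" \<comment> \<open>\<open>\<Delta> \<otimes> id\<close>\<close>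
  where "comult_left s \<Delta> t = coset (trilin_rels s)
    (lin_ext free_scale
      (\<lambda>(a, b). lin_ext free_scale (\<lambda>(a1, a2). gen (a1, a2, b)) (rep (\<Delta> a))) (rep t))"

definition comult_right ::
    "('k::field \<Rightarrow> 'c::ab_group_add \<Rightarrow> 'c) \<Rightarrow> ('c \<Rightarrow> ('c \<times> 'c \<Rightarrow>\<^sub>0 'k) set) \<Rightarrow>
      ('c \<times> 'c \<Rightarrow>\<^sub>0 'k) set \<Rightarrow> ('c \<times> 'c \<times> 'c \<Rightarrow>\<^sub>0 'k) set" \<comment> \<open>\<open>id \<otimes> \<Delta>\<close>\<close>
  where "comult_right s \<Delta> t = coset (trilin_rels s)
    (lin_ext free_scale
      (\<lambda>(a, b). lin_ext free_scale (\<lambda>(b1, b2). gen (a, b1, b2)) (rep (\<Delta> b))) (rep t))"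

section \<open>Coalgebras\<close>

text \<open>The assumptions \<open>comult_add\<close> and \<open>comult_scale\<close> say that \<open>\<Delta>\<close> is a linear map from \<open>C\<close> to the
  quotient space \<open>C \<otimes> C\<close>.\<close>

locale coalgebra = vector_space scale
  for scale :: "'k::field \<Rightarrow> 'c::ab_group_add \<Rightarrow> 'c" +
  fixes \<Delta> :: "'c \<Rightarrow> ('c \<times> 'c \<Rightarrow>\<^sub>0 'k) set"
    and \<epsilon> :: "'c \<Rightarrow> 'k"
  assumes comult_closed: "\<Delta> x \<in> tensor2 scale"
    and comult_add: "p \<in> \<Delta> x \<Longrightarrow> q \<in> \<Delta> y \<Longrightarrow> p + q \<in> \<Delta> (x + y)"
    and comult_scale: "p \<in> \<Delta> x \<Longrightarrow> free_scale c p \<in> \<Delta> (scale c x)"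
    and counit_linear: "Vector_Spaces.linear scale (*) \<epsilon>"
    and coassoc: "comult_left scale \<Delta> (\<Delta> x) = comult_right scale \<Delta> (\<Delta> x)"
    and counit_left: "lin_ext scale (\<lambda>(a, b). scale (\<epsilon> a) b) (rep (\<Delta> x)) = x"
    and counit_right: "lin_ext scale (\<lambda>(a, b). scale (\<epsilon> b) a) (rep (\<Delta> x)) = x"
begin

text \<open>\<open>V\<close> is a right subcomodule of \<open>C\<close> if \<open>\<Delta>\<close> maps \<open>V\<close> into (the image in \<open>C \<otimes> C\<close> of) \<open>V \<otimes> C\<close>.\<close>

definition right_coideal :: "'c set \<Rightarrow> bool"
  where "right_coideal V \<longleftrightarrow> subspace V \<and>
    (\<forall>x\<in>V. \<exists>p\<in>\<Delta> x. Poly_Mapping.keys p \<subseteq> V \<times> UNIV)"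

end

locale chain_coalgebra = coalgebra +
  assumes right_coideals_chain:
    "right_coideal V \<Longrightarrow> right_coideal W \<Longrightarrow> V \<subseteq> W \<or> W \<subseteq> V"

section \<open>The dual algebra\<close>

definition convolution ::
    "('c \<Rightarrow> ('c \<times> 'c \<Rightarrow>\<^sub>0 'k::field) set) \<Rightarrow> ('c \<Rightarrow> 'k) \<Rightarrow> ('c \<Rightarrow> 'k) \<Rightarrow> 'c \<Rightarrow> 'k"
  where "convolution \<Delta> f g x = lin_ext (*) (\<lambda>(a, b). f a * g b) (rep (\<Delta> x))"

definition dual_algebra ::
    "('k::field \<Rightarrow> 'c::ab_group_add \<Rightarrow> 'c) \<Rightarrow> ('c \<Rightarrow> ('c \<times> 'c \<Rightarrow>\<^sub>0 'k) set) \<Rightarrow> ('c \<Rightarrow> 'k) \<Rightarrow>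
      ('c \<Rightarrow> 'k) ring"
  where "dual_algebra s \<Delta> \<epsilon> =
    \<lparr>carrier = {f. Vector_Spaces.linear s (*) f}, monoid.mult = convolution \<Delta>, one = \<epsilon>,
     zero = (\<lambda>_. 0), add = (\<lambda>f g x. f x + g x)\<rparr>"

lemma lin_ext_superset:
  assumes "vector_space s" "finite S" "Poly_Mapping.keys p \<subseteq> S"
  shows "lin_ext s h p = (\<Sum>x\<in>S. s (Poly_Mapping.lookup p x) (h x))"
proof -
  interpret vector_space s by fact
  show ?thesis unfolding lin_ext_def
    by (rule sum.mono_neutral_left) (use assms in \<open>auto simp: in_keys_iff\<close>)
qed

lemma lin_ext_gen: "vector_space s \<Longrightarrow> lin_ext s h (gen x) = h x"
  by (simp add: lin_ext_def gen_def vector_space.vector_space_assms)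

lemma linear_lin_ext:
  assumes "vector_space s"
  shows "Vector_Spaces.linear free_scale s (lin_ext s h)"
proof -
  interpret V: vector_space s by fact
  interpret F: vector_space "free_scale :: 'a \<Rightarrow> ('c \<Rightarrow>\<^sub>0 'a) \<Rightarrow> _" by (rule vector_space_free_scale)
  show ?thesis
  proof unfold_locales
    fix p q :: "'c \<Rightarrow>\<^sub>0 'a" and c
    let ?S = "Poly_Mapping.keys p \<union> Poly_Mapping.keys q"
    have "lin_ext s h r = (\<Sum>x\<in>?S. s (Poly_Mapping.lookup r x) (h x))"
      if "Poly_Mapping.keys r \<subseteq> ?S" for r
      by (rule lin_ext_superset) (use assms that in auto)
    then show "lin_ext s h (p + q) = lin_ext s h p + lin_ext s h q"
      using Poly_Mapping.keys_add[of p q]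
      by (simp add: lookup_add V.scale_left_distrib sum.distrib)
    have "Poly_Mapping.keys (free_scale c p) \<subseteq> Poly_Mapping.keys p"
      by (auto simp: in_keys_iff lookup_free_scale)
    from lin_ext_superset[OF assms _ this] show "lin_ext s h (free_scale c p) = s c (lin_ext s h p)"
      by (simp add: lookup_free_scale lin_ext_def V.scale_sum_right)
  qed
qed

lemma (in coalgebra) convolution_representative:
  assumes f: "Vector_Spaces.linear scale (*) f" and g: "Vector_Spaces.linear scale (*) g"
    and p: "p \<in> \<Delta> x"
  shows "convolution \<Delta> f g x = lin_ext (*) (\<lambda>(a, b). f a * g b) p"
proof -
  let ?h = "\<lambda>(a, b). f a * g b"
  interpret F: vector_space "free_scale :: 'k \<Rightarrow> ('c \<times> 'c \<Rightarrow>\<^sub>0 'k) \<Rightarrow> _"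
    by (rule vector_space_free_scale)
  have K: "vector_space ((*) :: 'k \<Rightarrow> _)"
    by unfold_locales (auto simp: algebra_simps)
  interpret L: Vector_Spaces.linear free_scale "(*)" "lin_ext (*) ?h"
    by (rule linear_lin_ext[OF K])
  interpret f: Vector_Spaces.linear scale "(*)" f by fact
  interpret g: Vector_Spaces.linear scale "(*)" g by fact
  have rel: "lin_ext (*) ?h r = 0" if "r \<in> bilin_rels scale" for r
    using that unfolding bilin_rels_def
  proof (rule L.eq_0_on_span[rotated])
    fix r
    assume "r \<in> (\<Union>y. slot_rels scale (\<lambda>x. (x, y)) \<union> slot_rels scale (\<lambda>x. (y, x)))"
    then show "lin_ext (*) ?h r = 0"
      by (auto simp: slot_rels_def L.diff L.scale lin_ext_gen[OF K] f.add g.add f.scale g.scale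
          distrib_left distrib_right)
  qed
  obtain p0 where p0: "\<Delta> x = coset (bilin_rels scale) p0"
    using comult_closed by (auto simp: tensor2_def)
  have eq: "lin_ext (*) ?h q = lin_ext (*) ?h p0" if "q \<in> \<Delta> x" for q
  proof -
    have "lin_ext (*) ?h (q - p0) = 0"
      using that by (intro rel) (simp add: p0 coset_def)
    then show ?thesis by (simp add: L.diff)
  qed
  have "rep (\<Delta> x) \<in> \<Delta> x"
    unfolding rep_def using p by (rule someI)
  then show ?thesis using eq p by (simp add: convolution_def)
qed

section \<open>Left noetherian chain domains\<close>

definition left_ideal :: "'a set \<Rightarrow> ('a, 'b) ring_scheme \<Rightarrow> bool"
  where "left_ideal I R \<longleftrightarrow> additive_subgroup I R \<and>
    (\<forall>a\<in>carrier R. \<forall>x\<in>I. a \<otimes>\<^bsub>R\<^esub> x \<in> I)"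

definition gen_left_ideal :: "('a, 'b) ring_scheme \<Rightarrow> 'a set \<Rightarrow> 'a set"
  where "gen_left_ideal R S = \<Inter>{I. left_ideal I R \<and> S \<subseteq> I}"

locale left_noetherian_chain_domain = ring R for R (structure) +
  assumes one_not_zero: "\<one> \<noteq> \<zero>"
    and no_zero_divisors:
      "a \<in> carrier R \<Longrightarrow> b \<in> carrier R \<Longrightarrow> a \<otimes> b = \<zero> \<Longrightarrow> a = \<zero> \<or> b = \<zero>"
    and left_noetherian:
      "left_ideal I R \<Longrightarrow> \<exists>S\<subseteq>carrier R. finite S \<and> I = gen_left_ideal R S"
    and left_ideals_chain:
      "left_ideal I R \<Longrightarrow> left_ideal J R \<Longrightarrow> I \<subseteq> J \<or> J \<subseteq> I"

end

theory Submission
  imports Defs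
begin

text \<open>
  The dual algebra \<open>A\<close> acts on \<open>C\<close> from both sides: \<open>f \<rightharpoonup> x = x\<^sub>1 f(x\<^sub>2)\<close> and
  \<open>x \<leftharpoonup> f = f(x\<^sub>1) x\<^sub>2\<close>.  Both actions recover the product,
  \<open>(f \<star> g)(x) = f (g \<rightharpoonup> x) = g (x \<leftharpoonup> f)\<close>, and coassociativity makes them commute.  The right
  coideals are exactly the subspaces stable under the left action (\<open>right_coideal_iff_lhit\<close>), so
  every \<open>x \<mapsto> x \<leftharpoonup> f\<close> is an endomorphism of \<open>C\<close> for this structure: its kernel and its images and
  preimages of right coideals are right coideals.  Each element lies in a right coideal of finite
  dimension, and so in a chain coalgebra all proper right coideals have finite dimension.

  If \<open>C\<close> has infinite dimension and \<open>f \<noteq> 0\<close>, then the kernel of \<open>x \<mapsto> x \<leftharpoonup> f\<close> is proper, hence of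
  finite dimension, hence the image is all of \<open>C\<close>; therefore \<open>A\<close> has no zero divisors.  Let \<open>C\<^sub>0\<close> be
  the least nonzero right coideal and \<open>C\<^sub>1\<close> the least one not contained in \<open>C\<^sub>0\<close>.  A functional that
  does not vanish on \<open>C\<^sub>0\<close> acts injectively on the right and is therefore invertible
  (\<open>invertible_if_nonzero_on_socle\<close>).

  Take \<open>t \<in> A\<close> that vanishes on \<open>C\<^sub>0\<close> but not on \<open>C\<^sub>1\<close>.  Then \<open>L x = x \<leftharpoonup> t\<close> is onto with kernel
  \<open>C\<^sub>0\<close>, by the chain condition.  To divide by \<open>t\<close> on the right the same kernel is needed for
  \<open>R x = t \<rightharpoonup> x\<close>, which does not commute with the left action; here the finite dimension of
  \<open>C\<^sub>0\<close> enters.  Since \<open>R\<close> vanishes on \<open>C\<^sub>0\<close> there is a linear \<open>\<psi>\<close> with \<open>R = \<psi> L\<close>.  Both \<open>L\<close> and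
  \<open>R\<close> map \<open>C\<^sub>1\<close> onto \<open>C\<^sub>0\<close>, so \<open>\<psi>\<close> maps \<open>C\<^sub>0\<close> onto itself and is injective there (\<open>twist\<close>).  The
  operator \<open>L\<close> is locally nilpotent, and an induction along its powers extends the injectivity of
  \<open>\<psi>\<close> from \<open>C\<^sub>0\<close> to \<open>C\<close>: the kernel of \<open>R\<close> is \<open>C\<^sub>0\<close> (\<open>lhit_t_eq_0_imp_socle\<close>), and \<open>R\<close> is locally
  nilpotent too.

  A functional that vanishes on \<open>C\<^sub>0\<close> thus factors through \<open>R\<close>, that is, has the form \<open>g \<star> t\<close>.
  Splitting off factors \<open>t\<close> ends after finitely many steps because \<open>R\<close> is locally nilpotent, and it
  leaves a unit (\<open>factorization\<close>).  That every nonzero left ideal is generated by a power of \<open>t\<close>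
  follows formally (\<open>left_noetherian_chain_domainI\<close>).
\<close>

section \<open>Linear algebra on subspaces of finite dimension\<close>

definition finite_dim :: "('k::field \<Rightarrow> 'v::ab_group_add \<Rightarrow> 'v) \<Rightarrow> 'v set \<Rightarrow> bool"
  where "finite_dim s V \<longleftrightarrow> (\<exists>B. finite B \<and> V \<subseteq> module.span s B)"

context vector_space
begin

lemma finite_dim_subset: "finite_dim scale W \<Longrightarrow> V \<subseteq> W \<Longrightarrow> finite_dim scale V"
  by (auto simp: finite_dim_def)

lemma finite_dim_zero: "finite_dim scale {0}"
  by (auto simp: finite_dim_def intro!: exI[of _ "{}"])

lemma finite_dim_basisE:
  assumes "finite_dim scale V"
  obtains B where "B \<subseteq> V" "independent B" "V \<subseteq> span B" "finite B" "card B = dim V"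
proof -
  obtain S where S: "finite S" "V \<subseteq> span S"
    using assms by (auto simp: finite_dim_def)
  obtain B where B: "B \<subseteq> V" "independent B" "V \<subseteq> span B" "card B = dim V"
    using basis_exists by blast
  moreover have "finite B"
    using independent_span_bound[OF S(1) B(2)] B(1) S(2) by blast
  ultimately show ?thesis using that by blast
qed

lemma subspace_eq_if_dim_le:
  assumes V: "subspace V" and W: "finite_dim scale W" and "V \<subseteq> W" and le: "dim W \<le> dim V"
  shows "V = W"
proof (rule ccontr)
  assume "V \<noteq> W"
  then obtain x where x: "x \<in> W" "x \<notin> V" using \<open>V \<subseteq> W\<close> by blast
  obtain B where B: "B \<subseteq> V" "independent B" "V \<subseteq> span B" "finite B" "card B = dim V"
    using finite_dim_basisE[OF finite_dim_subset[OF W \<open>V \<subseteq> W\<close>]] .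
  obtain B' where B': "W \<subseteq> span B'" "finite B'" "card B' = dim W"
    using finite_dim_basisE[OF W] .
  have "span B \<subseteq> V" using B(1) V by (rule span_minimal)
  then have "x \<notin> span B" using x by blast
  then have "independent (insert x B)" using B(2) by (rule independent_insertI)
  moreover have "insert x B \<subseteq> span B'" using x B(1) \<open>V \<subseteq> W\<close> B'(1) by blast
  ultimately have "card (insert x B) \<le> card B'"
    using independent_span_bound B'(2) by blast
  moreover have "x \<notin> B" using x B(1) by blast
  ultimately show False using B B' le by simp
qed

lemma finite_dim_image:
  assumes "Vector_Spaces.linear scale scale F" and "finite_dim scale V"
  shows "finite_dim scale (F ` V)"
proof -
  interpret F: Vector_Spaces.linear scale scale F by fact
  show ?thesis using assms(2) F.spans_image unfolding finite_dim_def by blast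
qed

lemma dim_image_le:
  assumes "Vector_Spaces.linear scale scale F" and V: "finite_dim scale V"
  shows "dim (F ` V) \<le> dim V"
proof -
  interpret F: Vector_Spaces.linear scale scale F by fact
  obtain B where B: "V \<subseteq> span B" "finite B" "card B = dim V"
    using finite_dim_basisE[OF V] .
  have "dim (F ` V) \<le> card (F ` B)"
    by (rule dim_le_card[OF F.spans_image[OF B(1)]]) (use B in simp)
  also have "\<dots> \<le> dim V" using card_image_le[OF B(2), of F] B by simp
  finally show ?thesis .
qed

lemma inj_if_dim_image_ge:
  assumes "Vector_Spaces.linear scale scale F" and V: "finite_dim scale V"
    and le: "dim V \<le> dim (F ` V)" and x: "x \<in> V" "F x = 0"
  shows "x = 0"
proof (rule ccontr)
  assume "x \<noteq> 0"
  interpret F: Vector_Spaces.linear scale scale F by fact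
  obtain B where B: "{x} \<subseteq> B" "B \<subseteq> V" "independent B" "V \<subseteq> span B"
    using maximal_independent_subset_extend[of "{x}" V] x \<open>x \<noteq> 0\<close> by auto
  obtain S where S: "finite S" "V \<subseteq> span S" using V by (auto simp: finite_dim_def)
  have fin: "finite B" using independent_span_bound[OF S(1) B(3)] B(2) S(2) by blast
  have "F ` V \<subseteq> span (F ` B)" by (rule F.spans_image[OF B(4)])
  also have "F ` B = insert 0 (F ` (B - {x}))" using B(1) x by auto
  finally have "F ` V \<subseteq> span (F ` (B - {x}))" by simp
  then have "dim (F ` V) \<le> card (F ` (B - {x}))"
    by (rule dim_le_card) (use fin in simp)
  also have "\<dots> \<le> card (B - {x})" by (rule card_image_le) (use fin in simp)
  also have "\<dots> < card B" using fin B(1) by (intro psubset_card_mono) auto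
  also have "card B = dim V" by (rule basis_card_eq_dim) (use B in auto)
  finally show False using le by simp
qed

text \<open>A linear map that is not onto still has a one-sided inverse on its range, through
  which maps vanishing on the kernel of \<open>F\<close> can be factored.\<close>

lemma linear_section:
  assumes "Vector_Spaces.linear scale scale F"
  obtains s where "Vector_Spaces.linear scale scale s" "\<And>x. F (s (F x)) = F x"
proof -
  interpret P: vector_space_pair scale scale ..
  show ?thesis
    using P.linear_exists_right_inverse_on[OF assms subspace_UNIV] that by auto
qed

lemma finite_dim_if_kernel_range:
  assumes "Vector_Spaces.linear scale scale F"
    and K: "finite_dim scale {x. F x = 0}" and R: "finite_dim scale (range F)"
  shows "finite_dim scale UNIV"
proof -
  interpret F: Vector_Spaces.linear scale scale F by fact
  obtain s where "Vector_Spaces.linear scale scale s" and s: "\<And>x. F (s (F x)) = F x"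
    using linear_section[OF assms(1)] by blast
  interpret s: Vector_Spaces.linear scale scale s by fact
  obtain B where B: "finite B" "{x. F x = 0} \<subseteq> span B" using K by (auto simp: finite_dim_def)
  obtain B' where B': "finite B'" "range F \<subseteq> span B'" using R by (auto simp: finite_dim_def)
  have "x \<in> span (B \<union> s ` B')" for x
  proof -
    have "x - s (F x) \<in> span (B \<union> s ` B')"
    proof -
      have "x - s (F x) \<in> {x. F x = 0}" by (simp add: F.diff s)
      then show ?thesis using B(2) span_mono[of B "B \<union> s ` B'"] by blast
    qed
    moreover have "s (F x) \<in> span (B \<union> s ` B')"
      using s.spans_image[OF B'(2)] span_mono[of "s ` B'" "B \<union> s ` B'"] by blast
    ultimately have "x - s (F x) + s (F x) \<in> span (B \<union> s ` B')" by (rule span_add)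
    then show ?thesis by simp
  qed
  then show ?thesis using B B' unfolding finite_dim_def by (intro exI[of _ "B \<union> s ` B'"]) auto
qed

lemma vector_space_field: "vector_space ((*) :: 'a \<Rightarrow> 'a \<Rightarrow> 'a)"
  by unfold_locales (auto simp: algebra_simps)

lemma functional_separating:
  assumes V: "subspace V" and x: "x \<notin> V"
  obtains f where "Vector_Spaces.linear scale (*) f" "\<And>v. v \<in> V \<Longrightarrow> f v = 0" "f x = 1"
proof -
  interpret P: vector_space_pair scale "(*)"
    by (rule vector_space_pair.intro[OF vector_space_axioms vector_space_field])
  obtain B where B: "B \<subseteq> V" "independent B" "V \<subseteq> span B"
    using maximal_independent_subset[of V] .
  have sp: "span B \<subseteq> V" using B(1) V by (rule span_minimal)
  have "independent (insert x B)"
    by (rule independent_insertI) (use sp x B in auto)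
  then obtain f where f: "Vector_Spaces.linear scale (*) f"
      "\<forall>b\<in>insert x B. f b = (if b = x then 1 else 0)"
    using P.linear_independent_extend[of "insert x B" "\<lambda>b. if b = x then 1 else 0"] by blast
  interpret f: Vector_Spaces.linear scale "(*)" f by fact
  have "f v = 0" if "v \<in> V" for v
    by (rule f.eq_0_on_span[of B]) (use f(2) x B that in auto)
  then show ?thesis using that f by simp
qed

lemma functional_eq_zero:
  assumes "\<And>f. Vector_Spaces.linear scale (*) f \<Longrightarrow> f x = 0"
  shows "x = 0"
  using functional_separating[of "{0}" x] assms by (metis subspace_single_0 singletonD zero_neq_one)

text \<open>Functionals extend from the range of \<open>F\<close> to the whole space; composing \<open>f\<close> with a section of
  \<open>F\<close> does this.\<close>

lemma functional_factors:
  assumes F: "Vector_Spaces.linear scale scale F" and f: "Vector_Spaces.linear scale (*) f"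
    and ker: "\<And>x. F x = 0 \<Longrightarrow> f x = 0"
  obtains g where "Vector_Spaces.linear scale (*) g" "\<And>x. f x = g (F x)"
proof -
  interpret F: Vector_Spaces.linear scale scale F by fact
  interpret f: Vector_Spaces.linear scale "(*)" f by fact
  obtain s where s: "Vector_Spaces.linear scale scale s" "\<And>x. F (s (F x)) = F x"
    using linear_section[OF F] by blast
  show ?thesis
  proof (rule that)
    show "Vector_Spaces.linear scale (*) (f \<circ> s)"
      by (rule Vector_Spaces.linear_compose[OF s(1) f])
    fix x
    have "f (x - s (F x)) = 0" by (rule ker) (simp add: F.diff s(2))
    then show "f x = (f \<circ> s) (F x)" by (simp add: f.diff)
  qed
qed

end

section \<open>Linear maps out of tensor products\<close>

lemma lin_ext_lin_ext:
  assumes "vector_space s"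
  shows "lin_ext s H (lin_ext free_scale G p) = lin_ext s (\<lambda>x. lin_ext s H (G x)) p"
proof -
  interpret L: Vector_Spaces.linear free_scale s "lin_ext s H" by (rule linear_lin_ext[OF assms])
  show ?thesis
    unfolding lin_ext_def[of free_scale] lin_ext_def[of s "\<lambda>x. lin_ext s H (G x)"]
    by (simp add: L.sum L.scale)
qed

lemma linear_of_lin_ext:
  assumes "Vector_Spaces.linear s s' F"
  shows "F (lin_ext s h p) = lin_ext s' (\<lambda>x. F (h x)) p"
proof -
  interpret F: Vector_Spaces.linear s s' F by fact
  show ?thesis by (simp add: lin_ext_def F.sum F.scale)
qed

lemma lin_ext_add:
  assumes "vector_space s"
  shows "lin_ext s (\<lambda>x. h x + h' x) p = lin_ext s h p + lin_ext s h' p"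
proof -
  interpret vector_space s by fact
  show ?thesis by (simp add: lin_ext_def scale_right_distrib sum.distrib)
qed

lemma lin_ext_slot_rels:
  assumes "Vector_Spaces.linear s s' (\<lambda>x. H (h x))" and "r \<in> slot_rels s h"
  shows "lin_ext s' H r = 0"
proof -
  interpret H: Vector_Spaces.linear s s' "\<lambda>x. H (h x)" by fact
  have V: "vector_space s'" ..
  interpret L: Vector_Spaces.linear free_scale s' "lin_ext s' H" by (rule linear_lin_ext[OF V])
  show ?thesis
    using assms(2) by (auto simp: slot_rels_def H.add H.scale L.diff L.scale lin_ext_gen[OF V])
qed

text \<open>The universal property of \<open>C \<otimes> C\<close>: a bilinear map kills the relations.\<close>

lemma lin_ext_bilin_rels:
  assumes V: "vector_space s'"
    and "\<And>y. Vector_Spaces.linear s s' (\<lambda>x. H (x, y))"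
      "\<And>y. Vector_Spaces.linear s s' (\<lambda>x. H (y, x))"
    and "r \<in> bilin_rels s"
  shows "lin_ext s' H r = 0"
proof -
  interpret L: Vector_Spaces.linear free_scale s' "lin_ext s' H" by (rule linear_lin_ext[OF V])
  note slots = assms(2,3)[THEN lin_ext_slot_rels[where H = H]]
  from assms(4) show ?thesis unfolding bilin_rels_def
    by (rule L.eq_0_on_span[rotated]) (use slots in blast)
qed

lemma lin_ext_trilin_rels:
  assumes V: "vector_space s'"
    and "\<And>y z. Vector_Spaces.linear s s' (\<lambda>x. H (x, y, z))"
      "\<And>y z. Vector_Spaces.linear s s' (\<lambda>x. H (y, x, z))"
      "\<And>y z. Vector_Spaces.linear s s' (\<lambda>x. H (y, z, x))"
    and "r \<in> trilin_rels s"
  shows "lin_ext s' H r = 0"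
proof -
  interpret L: Vector_Spaces.linear free_scale s' "lin_ext s' H" by (rule linear_lin_ext[OF V])
  note slots = assms(2,3,4)[THEN lin_ext_slot_rels[where H = H]]
  from assms(5) show ?thesis unfolding trilin_rels_def
    by (rule L.eq_0_on_span[rotated]) (use slots in blast)
qed

lemma lin_ext_free_gen: "lin_ext free_scale gen p = (p :: 'x \<Rightarrow>\<^sub>0 'k::field)"
proof (rule poly_mapping_eqI)
  fix y
  have "Poly_Mapping.lookup (lin_ext free_scale gen p) y =
      (\<Sum>x\<in>Poly_Mapping.keys p. Poly_Mapping.lookup p x * (1 when x = y))"
    by (simp add: lin_ext_def lookup_sum lookup_free_scale gen_def lookup_single)
  also have "\<dots> = (\<Sum>x\<in>Poly_Mapping.keys p. if x = y then Poly_Mapping.lookup p x else 0)"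
    by (rule sum.cong) (auto simp: when_def)
  also have "\<dots> = Poly_Mapping.lookup p y"
    by (simp add: in_keys_iff)
  finally show "Poly_Mapping.lookup (lin_ext free_scale gen p) y = Poly_Mapping.lookup p y" .
qed

lemma subspace_bilin_rels:
  fixes s :: "'k::field \<Rightarrow> 'c::ab_group_add \<Rightarrow> 'c"
  shows "module.subspace free_scale (bilin_rels s)"
proof -
  interpret F: vector_space "free_scale :: 'k \<Rightarrow> ('c \<times> 'c \<Rightarrow>\<^sub>0 'k) \<Rightarrow> _"
    by (rule vector_space_free_scale)
  show ?thesis unfolding bilin_rels_def by (rule F.subspace_span)
qed

lemma zero_trilin_rels:
  fixes s :: "'k::field \<Rightarrow> 'c::ab_group_add \<Rightarrow> 'c"
  shows "0 \<in> trilin_rels s"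
proof -
  interpret F: vector_space "free_scale :: 'k \<Rightarrow> ('c \<times> 'c \<times> 'c \<Rightarrow>\<^sub>0 'k) \<Rightarrow> _"
    by (rule vector_space_free_scale)
  show ?thesis unfolding trilin_rels_def by (rule F.span_zero)
qed

section \<open>The two actions of the dual algebra\<close>

context coalgebra
begin

abbreviation functional :: "('c \<Rightarrow> 'k) \<Rightarrow> bool"
  where "functional \<equiv> Vector_Spaces.linear scale (*)"

abbreviation convolve :: "('c \<Rightarrow> 'k) \<Rightarrow> ('c \<Rightarrow> 'k) \<Rightarrow> 'c \<Rightarrow> 'k" (infixl "\<star>" 70)
  where "f \<star> g \<equiv> convolution \<Delta> f g"

lemma rep_in_comult: "rep (\<Delta> x) \<in> \<Delta> x"
proof -
  interpret F: vector_space "free_scale :: 'k \<Rightarrow> ('c \<times> 'c \<Rightarrow>\<^sub>0 'k) \<Rightarrow> _"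
    by (rule vector_space_free_scale)
  obtain p where "\<Delta> x = coset (bilin_rels scale) p"
    using comult_closed by (auto simp: tensor2_def)
  then have "p \<in> \<Delta> x"
    using F.subspace_0[OF subspace_bilin_rels] by (simp add: coset_def)
  then show ?thesis unfolding rep_def by (rule someI)
qed

lemma in_comult_iff:
  assumes p: "p \<in> \<Delta> x"
  shows "q \<in> \<Delta> x \<longleftrightarrow> q - p \<in> bilin_rels scale"
proof -
  interpret F: vector_space "free_scale :: 'k \<Rightarrow> ('c \<times> 'c \<Rightarrow>\<^sub>0 'k) \<Rightarrow> _"
    by (rule vector_space_free_scale)
  obtain p0 where p0: "\<Delta> x = coset (bilin_rels scale) p0"
    using comult_closed by (auto simp: tensor2_def)
  have "p - p0 \<in> bilin_rels scale" using p p0 by (simp add: coset_def)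
  moreover have "q - p0 = (q - p) + (p - p0)" "q - p = (q - p0) - (p - p0)" by simp_all
  ultimately show ?thesis
    using F.subspace_add[OF subspace_bilin_rels] F.subspace_diff[OF subspace_bilin_rels]
    unfolding p0 coset_def by (metis mem_Collect_eq)
qed

lemma bilinear_representative:
  assumes V: "vector_space s'"
    and H: "\<And>y. Vector_Spaces.linear scale s' (\<lambda>x. H (x, y))"
      "\<And>y. Vector_Spaces.linear scale s' (\<lambda>x. H (y, x))"
    and p: "p \<in> \<Delta> x"
  shows "lin_ext s' H (rep (\<Delta> x)) = lin_ext s' H p"
proof -
  interpret L: Vector_Spaces.linear free_scale s' "lin_ext s' H" by (rule linear_lin_ext[OF V])
  have "lin_ext s' H (rep (\<Delta> x) - p) = 0"
    by (rule lin_ext_bilin_rels[OF V H]) (use in_comult_iff[OF p] rep_in_comult in blast)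
  then show ?thesis by (simp add: L.diff)
qed

text \<open>Sums and multiples of representatives of tensors represent the sums and multiples, so
  \<open>x \<mapsto> H(x\<^sub>1, x\<^sub>2)\<close> inherits linearity from \<open>\<Delta>\<close>.\<close>

lemma linear_bilinear_comult:
  assumes V: "vector_space s'"
    and H: "\<And>y. Vector_Spaces.linear scale s' (\<lambda>x. H (x, y))"
      "\<And>y. Vector_Spaces.linear scale s' (\<lambda>x. H (y, x))"
  shows "Vector_Spaces.linear scale s' (\<lambda>x. lin_ext s' H (rep (\<Delta> x)))"
proof -
  interpret L: Vector_Spaces.linear free_scale s' "lin_ext s' H" by (rule linear_lin_ext[OF V])
  note r = bilinear_representative[OF V H]
  show ?thesis
    by (simp add: Vector_Spaces.linear_iff V vector_space_axioms
        r[OF comult_add[OF rep_in_comult rep_in_comult]] r[OF comult_scale[OF rep_in_comult]]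
        L.add L.scale)
qed

definition lhit :: "('c \<Rightarrow> 'k) \<Rightarrow> 'c \<Rightarrow> 'c" (infixr "\<rightharpoonup>" 75)
  where "f \<rightharpoonup> x = lin_ext scale (\<lambda>(a, b). scale (f b) a) (rep (\<Delta> x))"

definition rhit :: "'c \<Rightarrow> ('c \<Rightarrow> 'k) \<Rightarrow> 'c" (infixl "\<leftharpoonup>" 75)
  where "x \<leftharpoonup> f = lin_ext scale (\<lambda>(a, b). scale (f a) b) (rep (\<Delta> x))"

lemma bilinear_scale_functional:
  assumes "functional f"
  shows "Vector_Spaces.linear scale scale (\<lambda>x. scale (f x) y)"
    "Vector_Spaces.linear scale scale (\<lambda>x. scale (f y) x)"
proof -
  interpret f: Vector_Spaces.linear scale "(*)" f by fact
  show "Vector_Spaces.linear scale scale (\<lambda>x. scale (f x) y)"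
    "Vector_Spaces.linear scale scale (\<lambda>x. scale (f y) x)"
    by (simp_all add: Vector_Spaces.linear_iff vector_space_axioms f.add f.scale algebra_simps)
qed

lemma linear_lhit: "functional f \<Longrightarrow> Vector_Spaces.linear scale scale (\<lambda>x. f \<rightharpoonup> x)"
  unfolding lhit_def
  by (rule linear_bilinear_comult[OF vector_space_axioms]) (simp_all add: bilinear_scale_functional)

lemma linear_rhit: "functional f \<Longrightarrow> Vector_Spaces.linear scale scale (\<lambda>x. x \<leftharpoonup> f)"
  unfolding rhit_def
  by (rule linear_bilinear_comult[OF vector_space_axioms]) (simp_all add: bilinear_scale_functional)

lemma lhit_representative:
  assumes f: "functional f" and p: "p \<in> \<Delta> x"
  shows "f \<rightharpoonup> x = lin_ext scale (\<lambda>(a, b). scale (f b) a) p"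
  unfolding lhit_def
  by (rule bilinear_representative[OF vector_space_axioms _ _ p])
    (simp_all add: bilinear_scale_functional[OF f])

lemma convolution_lhit:
  assumes "functional f"
  shows "(f \<star> g) x = f (g \<rightharpoonup> x)"
proof -
  interpret f: Vector_Spaces.linear scale "(*)" f by fact
  show ?thesis
    unfolding convolution_def lhit_def linear_of_lin_ext[OF assms]
    by (simp add: f.scale case_prod_unfold mult.commute)
qed

lemma convolution_rhit:
  assumes "functional g"
  shows "(f \<star> g) x = g (x \<leftharpoonup> f)"
proof -
  interpret g: Vector_Spaces.linear scale "(*)" g by fact
  show ?thesis
    unfolding convolution_def rhit_def linear_of_lin_ext[OF assms]
    by (simp add: g.scale case_prod_unfold)
qed

lemma functional_convolution:
  assumes "functional f" "functional g"
  shows "functional (f \<star> g)"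
proof -
  have "functional (f \<circ> (\<lambda>x. g \<rightharpoonup> x))"
    by (rule Vector_Spaces.linear_compose[OF linear_lhit[OF assms(2)] assms(1)])
  then show ?thesis
    by (simp add: o_def convolution_lhit[OF assms(1), symmetric])
qed

lemma counit_lhit: "\<epsilon> \<rightharpoonup> x = x"
  unfolding lhit_def by (rule counit_right)

lemma counit_rhit: "x \<leftharpoonup> \<epsilon> = x"
  unfolding rhit_def by (rule counit_left)

lemma counit_convolution: "functional f \<Longrightarrow> \<epsilon> \<star> f = f" "functional f \<Longrightarrow> f \<star> \<epsilon> = f"
  by (auto simp: fun_eq_iff convolution_rhit[of f] convolution_lhit[of f] counit_rhit counit_lhit)

lemma functional_mult:
  assumes "functional f"
  shows "functional (\<lambda>x. f x * c)" "functional (\<lambda>x. c * f x)"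
proof -
  interpret f: Vector_Spaces.linear scale "(*)" f by fact
  show "functional (\<lambda>x. f x * c)" "functional (\<lambda>x. c * f x)"
    by (simp_all add: Vector_Spaces.linear_iff vector_space_axioms vector_space_field
        f.add f.scale distrib_left distrib_right mult.left_commute)
qed

text \<open>The product \<open>f a * g b * h c\<close> is trilinear, so it defines a functional on \<open>C \<otimes> C \<otimes> C\<close>; evaluated
  on the two sides of the coassociativity law it gives the two bracketings.\<close>

lemma convolution_assoc:
  assumes f: "functional f" and g: "functional g" and h: "functional h"
  shows "(f \<star> g) \<star> h = f \<star> (g \<star> h)"
proof
  fix x
  let ?H = "\<lambda>(a, b, c). f a * g b * h c"
  let ?P = "lin_ext free_scale
      (\<lambda>(a, b). lin_ext free_scale (\<lambda>(a1, a2). gen (a1, a2, b)) (rep (\<Delta> a))) (rep (\<Delta> x))"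
  let ?Q = "lin_ext free_scale
      (\<lambda>(a, b). lin_ext free_scale (\<lambda>(b1, b2). gen (a, b1, b2)) (rep (\<Delta> b))) (rep (\<Delta> x))"
  note K = vector_space_field
  \<comment> \<open>\<open>P\<close> and \<open>Q\<close> precede the interpretation because its simplification rules associate products of
    scalars to the left.\<close>
  have P: "lin_ext (*) ?H (lin_ext free_scale (\<lambda>(a1, a2). gen (a1, a2, b)) r) =
      lin_ext (*) (\<lambda>(a1, a2). f a1 * g a2) r * h b" for b r
    unfolding lin_ext_lin_ext[OF K] split_def lin_ext_gen[OF K]
    by (simp add: lin_ext_def sum_distrib_right mult.assoc)
  have Q: "lin_ext (*) ?H (lin_ext free_scale (\<lambda>(b1, b2). gen (a, b1, b2)) r) =
      f a * lin_ext (*) (\<lambda>(b1, b2). g b1 * h b2) r" for a r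
    unfolding lin_ext_lin_ext[OF K] split_def lin_ext_gen[OF K]
    by (simp add: lin_ext_def sum_distrib_left mult.assoc mult.left_commute)
  interpret L: Vector_Spaces.linear free_scale "(*)" "lin_ext (*) ?H" by (rule linear_lin_ext[OF K])
  have "coset (trilin_rels scale) ?P = coset (trilin_rels scale) ?Q"
    using coassoc[of x] by (simp add: comult_left_def comult_right_def)
  then have "?P \<in> coset (trilin_rels scale) ?Q"
    by (metis (no_types, lifting) coset_def diff_self mem_Collect_eq zero_trilin_rels)
  then have "?P - ?Q \<in> trilin_rels scale" by (simp add: coset_def)
  then have "lin_ext (*) ?H (?P - ?Q) = 0"
    by (rule lin_ext_trilin_rels[OF K, rotated -1]) (simp_all add: functional_mult f g h)
  then have "lin_ext (*) ?H ?P = lin_ext (*) ?H ?Q" by (simp add: L.diff)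
  moreover have "lin_ext (*) ?H ?P = ((f \<star> g) \<star> h) x"
    by (subst lin_ext_lin_ext[OF K]) (simp add: P[unfolded split_def] split_def convolution_def)
  moreover have "lin_ext (*) ?H ?Q = (f \<star> (g \<star> h)) x"
    by (subst lin_ext_lin_ext[OF K]) (simp add: Q[unfolded split_def prod.collapse] split_def convolution_def)
  ultimately show "((f \<star> g) \<star> h) x = (f \<star> (g \<star> h)) x" by simp
qed

lemma eq_if_functionals_eq:
  assumes "\<And>h. functional h \<Longrightarrow> h x = h y"
  shows "x = y"
proof -
  have "x - y = 0"
  proof (rule functional_eq_zero)
    fix h assume h: "functional h"
    interpret h: Vector_Spaces.linear scale "(*)" h by fact
    show "h (x - y) = 0" using assms[OF h] by (simp add: h.diff)
  qed
  then show ?thesis by simp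
qed

text \<open>Functionals separate points, so the laws of the actions reduce to associativity of the product.\<close>

lemma lhit_convolution:
  assumes f: "functional f" and g: "functional g"
  shows "(f \<star> g) \<rightharpoonup> x = f \<rightharpoonup> g \<rightharpoonup> x"
proof (rule eq_if_functionals_eq)
  fix h assume h: "functional h"
  have "h ((f \<star> g) \<rightharpoonup> x) = ((h \<star> f) \<star> g) x"
    by (simp add: convolution_lhit[OF h, symmetric] convolution_assoc h f g)
  also have "\<dots> = h (f \<rightharpoonup> g \<rightharpoonup> x)"
    by (simp add: convolution_lhit functional_convolution h f g)
  finally show "h ((f \<star> g) \<rightharpoonup> x) = h (f \<rightharpoonup> g \<rightharpoonup> x)" .
qed

lemma lhit_rhit_commute:
  assumes f: "functional f" and g: "functional g"
  shows "f \<rightharpoonup> (x \<leftharpoonup> g) = (f \<rightharpoonup> x) \<leftharpoonup> g"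
proof (rule eq_if_functionals_eq)
  fix h assume h: "functional h"
  have "h (f \<rightharpoonup> (x \<leftharpoonup> g)) = (g \<star> (h \<star> f)) x"
    by (simp add: convolution_rhit convolution_lhit[OF h, symmetric] functional_convolution h f g)
  also have "\<dots> = ((g \<star> h) \<star> f) x" by (simp add: convolution_assoc f g h)
  also have "\<dots> = h ((f \<rightharpoonup> x) \<leftharpoonup> g)"
    by (simp only: convolution_lhit[OF functional_convolution[OF g h]] convolution_rhit[OF h])
  finally show "h (f \<rightharpoonup> (x \<leftharpoonup> g)) = h ((f \<rightharpoonup> x) \<leftharpoonup> g)" .
qed

text \<open>Bilinear forms separate the elements of \<open>C \<otimes> C\<close>: a functional on the free space that vanishes on
  the bilinearity relations is a bilinear form.\<close>

lemma tensor_eqI: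
  assumes p: "p \<in> \<Delta> x"
    and eq: "\<And>\<beta>. (\<And>y. functional (\<lambda>x. \<beta> (x, y))) \<Longrightarrow> (\<And>y. functional (\<lambda>x. \<beta> (y, x))) \<Longrightarrow>
      lin_ext (*) \<beta> q = lin_ext (*) \<beta> p"
  shows "q \<in> \<Delta> x"
proof (rule ccontr)
  interpret F: vector_space "free_scale :: 'k \<Rightarrow> ('c \<times> 'c \<Rightarrow>\<^sub>0 'k) \<Rightarrow> _"
    by (rule vector_space_free_scale)
  assume "q \<notin> \<Delta> x"
  then have "q - p \<notin> bilin_rels scale" using in_comult_iff[OF p] by blast
  then obtain \<phi> where \<phi>: "Vector_Spaces.linear free_scale (*) \<phi>"
      "\<And>r. r \<in> bilin_rels scale \<Longrightarrow> \<phi> r = 0" "\<phi> (q - p) = 1"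
    using F.functional_separating[OF subspace_bilin_rels] by blast
  interpret \<phi>: Vector_Spaces.linear free_scale "(*)" \<phi> by fact
  define \<beta> where "\<beta> k = \<phi> (gen k)" for k
  have ext: "\<phi> r = lin_ext (*) \<beta> r" for r
    using linear_of_lin_ext[OF \<phi>(1), of gen r] by (simp add: lin_ext_free_gen \<beta>_def[abs_def])
  have rel: "\<phi> r = 0" if "r \<in> slot_rels scale (\<lambda>x. (x, y)) \<union> slot_rels scale (\<lambda>x. (y, x))" for r y
    by (rule \<phi>(2)) (use that in \<open>auto simp: bilin_rels_def intro!: F.span_base\<close>)
  have "functional (\<lambda>x. \<beta> (x, y))" for y
  proof -
    have "\<phi> (gen (a + b, y) - gen (a, y) - gen (b, y)) = 0" for a b
      by (rule rel[of _ y]) (auto simp: slot_rels_def)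
    moreover have "\<phi> (gen (scale c a, y) - free_scale c (gen (a, y))) = 0" for c a
      by (rule rel[of _ y]) (auto simp: slot_rels_def)
    ultimately show ?thesis
      by (simp add: Vector_Spaces.linear_iff vector_space_axioms vector_space_field \<beta>_def
          \<phi>.diff \<phi>.scale \<phi>.add algebra_simps)
  qed
  moreover have "functional (\<lambda>x. \<beta> (y, x))" for y
  proof -
    have "\<phi> (gen (y, a + b) - gen (y, a) - gen (y, b)) = 0" for a b
      by (rule rel[of _ y]) (auto simp: slot_rels_def)
    moreover have "\<phi> (gen (y, scale c a) - free_scale c (gen (y, a))) = 0" for c a
      by (rule rel[of _ y]) (auto simp: slot_rels_def)
    ultimately show ?thesis
      by (simp add: Vector_Spaces.linear_iff vector_space_axioms vector_space_field \<beta>_def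
          \<phi>.diff \<phi>.scale \<phi>.add algebra_simps)
  qed
  ultimately have "\<phi> q = \<phi> p" using eq[of \<beta>] by (simp add: ext)
  then show False using \<phi>(3) by (simp add: \<phi>.diff)
qed

text \<open>Expanding the second tensor factors in a basis of \<open>C\<close> with coordinate functionals \<open>e b\<close>, the
  coefficient of the basis vector \<open>b\<close> becomes \<open>e b \<rightharpoonup> x\<close>.\<close>

lemma comult_expansion:
  "\<exists>E e. finite E \<and> (\<forall>b. functional (e b)) \<and> (\<Sum>b\<in>E. gen (e b \<rightharpoonup> x, b)) \<in> \<Delta> x"
proof -
  obtain B where B: "independent B" "UNIV \<subseteq> span B"
    using basis_exists[of UNIV] by blast
  then have sp: "span B = UNIV" by blast
  define e where "e b y = representation B y b" for b y
  have e: "functional (e b)" for b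
    using B by (simp add: Vector_Spaces.linear_iff vector_space_axioms vector_space_field e_def
        representation_add representation_scale sp)
  let ?p = "rep (\<Delta> x)"
  define E where "E = (\<Union>k\<in>Poly_Mapping.keys ?p. {b. e b (snd k) \<noteq> 0})"
  have fin: "finite E"
    unfolding E_def by (auto simp: e_def finite_representation)
  have expand: "(\<Sum>b\<in>E. scale (e b (snd k)) b) = snd k" if "k \<in> Poly_Mapping.keys ?p" for k
  proof -
    have "(\<Sum>b\<in>E. scale (e b (snd k)) b) = (\<Sum>b | e b (snd k) \<noteq> 0. scale (e b (snd k)) b)"
      by (rule sum.mono_neutral_right[OF fin]) (use that in \<open>auto simp: E_def\<close>)
    then show ?thesis
      using sum_nonzero_representation_eq[OF B(1), of "snd k"] by (simp add: e_def sp)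
  qed
  have "(\<Sum>b\<in>E. gen (e b \<rightharpoonup> x, b)) \<in> \<Delta> x"
  proof (rule tensor_eqI[OF rep_in_comult])
    fix \<beta> :: "'c \<times> 'c \<Rightarrow> 'k"
    assume \<beta>: "\<And>y. functional (\<lambda>x. \<beta> (x, y))" "\<And>y. functional (\<lambda>x. \<beta> (y, x))"
    interpret l: Vector_Spaces.linear scale "(*)" "\<lambda>x. \<beta> (x, y)" for y by (rule \<beta>)
    interpret r: Vector_Spaces.linear scale "(*)" "\<lambda>x. \<beta> (y, x)" for y by (rule \<beta>)
    interpret L: Vector_Spaces.linear free_scale "(*)" "lin_ext (*) \<beta>"
      by (rule linear_lin_ext[OF vector_space_field])
    have "lin_ext (*) \<beta> (\<Sum>b\<in>E. gen (e b \<rightharpoonup> x, b)) = (\<Sum>b\<in>E. \<beta> (e b \<rightharpoonup> x, b))"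
      by (simp add: L.sum lin_ext_gen[OF vector_space_field])
    also have "\<dots> = (\<Sum>b\<in>E. \<Sum>k\<in>Poly_Mapping.keys ?p.
        Poly_Mapping.lookup ?p k * (e b (snd k) * \<beta> (fst k, b)))"
      by (simp add: lhit_def lin_ext_def l.sum l.scale case_prod_beta)
    also have "\<dots> = (\<Sum>k\<in>Poly_Mapping.keys ?p.
        Poly_Mapping.lookup ?p k * \<beta> (fst k, \<Sum>b\<in>E. scale (e b (snd k)) b))"
      by (subst sum.swap) (simp add: r.sum r.scale sum_distrib_left)
    also have "\<dots> = lin_ext (*) \<beta> ?p"
      by (simp add: lin_ext_def expand)
    finally show "lin_ext (*) \<beta> (\<Sum>b\<in>E. gen (e b \<rightharpoonup> x, b)) = lin_ext (*) \<beta> ?p" .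
  qed
  with fin e show ?thesis by blast
qed

text \<open>The expansion of \<open>\<Delta> x\<close> over a basis has its first factors of the form \<open>f \<rightharpoonup> x\<close>, so stability
  under the action already exhibits \<open>\<Delta> x\<close> in \<open>V \<otimes> C\<close>.\<close>

lemma right_coideal_iff_lhit:
  "right_coideal V \<longleftrightarrow> subspace V \<and> (\<forall>f. functional f \<longrightarrow> (\<forall>x\<in>V. f \<rightharpoonup> x \<in> V))"
proof (intro iffI conjI allI impI ballI)
  assume "right_coideal V"
  then show V: "subspace V" by (simp add: right_coideal_def)
  fix f x assume f: "functional f" and "x \<in> V"
  then obtain p where p: "p \<in> \<Delta> x" "Poly_Mapping.keys p \<subseteq> V \<times> UNIV"
    using \<open>right_coideal V\<close> by (auto simp: right_coideal_def)
  show "f \<rightharpoonup> x \<in> V"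
    unfolding lhit_representative[OF f p(1)] lin_ext_def
    by (rule subspace_sum[OF V]) (use p(2) V in \<open>auto intro!: subspace_scale\<close>)
next
  assume V: "subspace V \<and> (\<forall>f. functional f \<longrightarrow> (\<forall>x\<in>V. f \<rightharpoonup> x \<in> V))"
  show "right_coideal V" unfolding right_coideal_def
  proof (intro conjI ballI)
    show "subspace V" using V by blast
    fix x assume x: "x \<in> V"
    obtain E e where e: "finite E" "\<forall>b. functional (e b)" "(\<Sum>b\<in>E. gen (e b \<rightharpoonup> x, b)) \<in> \<Delta> x"
      using comult_expansion[of x] by (elim exE conjE)
    have "Poly_Mapping.keys (\<Sum>b\<in>E. gen (e b \<rightharpoonup> x, b) :: _ \<Rightarrow>\<^sub>0 'k) \<subseteq>
        (\<Union>b\<in>E. Poly_Mapping.keys (gen (e b \<rightharpoonup> x, b) :: _ \<Rightarrow>\<^sub>0 'k))"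
      by (rule Poly_Mapping.keys_sum)
    also have "\<dots> \<subseteq> V \<times> UNIV"
    proof -
      have "e b \<rightharpoonup> x \<in> V" for b using V x e(2) by blast
      then show ?thesis by (auto simp: gen_def)
    qed
    finally show "\<exists>p\<in>\<Delta> x. Poly_Mapping.keys p \<subseteq> V \<times> UNIV" using e(3) by blast
  qed
qed

end

section \<open>Right coideals\<close>

context coalgebra
begin

lemma functional_zero: "functional (\<lambda>_. 0)"
  by (simp add: Vector_Spaces.linear_iff vector_space_axioms vector_space_field)

lemma functional_add: "functional f \<Longrightarrow> functional g \<Longrightarrow> functional (\<lambda>x. f x + g x)"
  by (simp add: Vector_Spaces.linear_iff algebra_simps)

lemma lhit_zero_left: "(\<lambda>_. 0) \<rightharpoonup> x = 0"
  by (simp add: lhit_def lin_ext_def)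

lemma lhit_add_left: "(\<lambda>x. f x + g x) \<rightharpoonup> x = f \<rightharpoonup> x + g \<rightharpoonup> x"
  unfolding lhit_def lin_ext_add[OF vector_space_axioms, symmetric]
  by (simp add: split_def scale_left_distrib)

lemma lhit_mult_left: "(\<lambda>x. c * f x) \<rightharpoonup> x = scale c (f \<rightharpoonup> x)"
  by (simp add: lhit_def lin_ext_def scale_sum_right split_def mult.left_commute)

lemma lhit_zero: "functional f \<Longrightarrow> f \<rightharpoonup> 0 = 0"
  by (metis linear_lhit Vector_Spaces.linear.axioms(3) module_hom.zero)

lemma right_coideal_subspace: "right_coideal V \<Longrightarrow> subspace V"
  by (simp add: right_coideal_iff_lhit)

lemma right_coideal_lhit: "right_coideal V \<Longrightarrow> functional f \<Longrightarrow> x \<in> V \<Longrightarrow> f \<rightharpoonup> x \<in> V"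
  by (simp add: right_coideal_iff_lhit)

lemma right_coideal_zero: "right_coideal {0}"
  by (simp add: right_coideal_iff_lhit lhit_zero)

definition orbit :: "'c \<Rightarrow> 'c set"
  where "orbit x = {f \<rightharpoonup> x | f. functional f}"

lemma mem_orbit: "x \<in> orbit x"
  unfolding orbit_def using counit_lhit[of x] counit_linear by (metis (mono_tags, lifting) mem_Collect_eq)

lemma right_coideal_orbit: "right_coideal (orbit x)"
  unfolding right_coideal_iff_lhit
proof (intro conjI allI impI ballI subspaceI)
  show "0 \<in> orbit x"
    unfolding orbit_def using lhit_zero_left functional_zero by (metis (mono_tags, lifting) mem_Collect_eq)
next
  fix y z assume "y \<in> orbit x" "z \<in> orbit x"
  then obtain f g where "functional f" "y = f \<rightharpoonup> x" "functional g" "z = g \<rightharpoonup> x"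
    by (auto simp: orbit_def)
  then show "y + z \<in> orbit x"
    unfolding orbit_def by (auto simp: lhit_add_left intro!: exI[of _ "\<lambda>x. f x + g x"] functional_add)
next
  fix c y assume "y \<in> orbit x"
  then obtain f where "functional f" "y = f \<rightharpoonup> x"
    by (auto simp: orbit_def)
  then show "scale c y \<in> orbit x"
    unfolding orbit_def by (auto simp: lhit_mult_left intro!: exI[of _ "\<lambda>x. c * f x"] functional_mult)
next
  fix f y assume f: "functional f" and "y \<in> orbit x"
  then obtain g where g: "functional g" "y = g \<rightharpoonup> x"
    by (auto simp: orbit_def)
  then have "f \<rightharpoonup> y = (f \<star> g) \<rightharpoonup> x" by (simp add: lhit_convolution f)
  then show "f \<rightharpoonup> y \<in> orbit x"
    unfolding orbit_def using functional_convolution[OF f g(1)] by blast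
qed

lemma orbit_subset: "right_coideal V \<Longrightarrow> x \<in> V \<Longrightarrow> orbit x \<subseteq> V"
  by (auto simp: orbit_def right_coideal_lhit)

text \<open>The fundamental theorem on comodules: the first tensor factors of one expression of \<open>\<Delta> x\<close> span
  a space containing all \<open>f \<rightharpoonup> x\<close>.\<close>

lemma finite_dim_orbit: "finite_dim scale (orbit x)"
  unfolding finite_dim_def
proof (intro exI conjI)
  let ?B = "fst ` Poly_Mapping.keys (rep (\<Delta> x))"
  show "finite ?B" by simp
  show "orbit x \<subseteq> span ?B"
    by (auto simp: orbit_def lhit_def lin_ext_def split_def intro!: span_sum intro: span_scale span_base)
qed

text \<open>The right action of a functional commutes with the left action of the algebra, so it is an
  endomorphism of \<open>C\<close> as a right comodule.\<close>

lemma right_coideal_rhit_vimage: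
  assumes f: "functional f" and V: "right_coideal V"
  shows "right_coideal {x. x \<leftharpoonup> f \<in> V}"
proof -
  interpret F: Vector_Spaces.linear scale scale "\<lambda>x. x \<leftharpoonup> f" by (rule linear_rhit[OF f])
  show ?thesis
    using F.subspace_linear_preimage[OF right_coideal_subspace[OF V]]
    by (auto simp: right_coideal_iff_lhit lhit_rhit_commute[OF _ f, symmetric]
        intro: right_coideal_lhit[OF V])
qed

lemma right_coideal_rhit_image:
  assumes f: "functional f" and V: "right_coideal V"
  shows "right_coideal ((\<lambda>x. x \<leftharpoonup> f) ` V)"
proof -
  interpret F: Vector_Spaces.linear scale scale "\<lambda>x. x \<leftharpoonup> f" by (rule linear_rhit[OF f])
  show ?thesis
    using F.subspace_image[OF right_coideal_subspace[OF V]]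
    by (auto simp: right_coideal_iff_lhit lhit_rhit_commute[OF _ f]
        intro!: imageI right_coideal_lhit[OF V])
qed

lemma right_coideal_rhit_kernel: "functional f \<Longrightarrow> right_coideal {x. x \<leftharpoonup> f = 0}"
  using right_coideal_rhit_vimage[OF _ right_coideal_zero] by simp

lemma functional_eq_counit_rhit: "functional f \<Longrightarrow> f x = \<epsilon> (x \<leftharpoonup> f)"
  using convolution_rhit[OF counit_linear, of f x] by (simp add: counit_convolution)

lemma counit_zero: "\<epsilon> 0 = 0"
  by (metis counit_linear Vector_Spaces.linear.axioms(3) module_hom.zero)

text \<open>From left to right apply the counit; conversely \<open>h (x \<leftharpoonup> f) = f (h \<rightharpoonup> x)\<close> and \<open>V\<close> is stable.\<close>

lemma rhit_eq_zero_on_right_coideal_iff: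
  assumes f: "functional f" and V: "right_coideal V"
  shows "(\<forall>x\<in>V. x \<leftharpoonup> f = 0) \<longleftrightarrow> (\<forall>x\<in>V. f x = 0)"
proof (intro iffI ballI)
  fix x assume "\<forall>x\<in>V. x \<leftharpoonup> f = 0" "x \<in> V"
  then show "f x = 0" by (simp add: functional_eq_counit_rhit[OF f] counit_zero)
next
  fix x assume *: "\<forall>x\<in>V. f x = 0" and x: "x \<in> V"
  show "x \<leftharpoonup> f = 0"
  proof (rule functional_eq_zero)
    fix h assume h: "functional h"
    have "h (x \<leftharpoonup> f) = f (h \<rightharpoonup> x)"
      by (simp add: convolution_rhit[OF h, symmetric] convolution_lhit[OF f])
    also have "\<dots> = 0" using * right_coideal_lhit[OF V h x] by blast
    finally show "h (x \<leftharpoonup> f) = 0" .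
  qed
qed

text \<open>In a chain coalgebra of infinite dimension the intersection is itself a member of the family, so
  \<open>next_coideal\<close> runs through the coradical filtration when iterated from \<open>{0}\<close>.\<close>

definition next_coideal :: "'c set \<Rightarrow> 'c set"
  where "next_coideal W = \<Inter>{U. right_coideal U \<and> \<not> U \<subseteq> W}"

lemma next_coideal_lower: "right_coideal U \<Longrightarrow> \<not> U \<subseteq> W \<Longrightarrow> next_coideal W \<subseteq> U"
  by (auto simp: next_coideal_def)

section \<open>The dual algebra as a ring\<close>

abbreviation dual :: "('c \<Rightarrow> 'k) ring"
  where "dual \<equiv> dual_algebra scale \<Delta> \<epsilon>"

lemma monoid_dual_algebra: "monoid dual"
  by (rule monoidI)
    (auto simp: dual_algebra_def functional_convolution counit_linear convolution_assoc
      counit_convolution)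

lemma ring_dual_algebra: "ring dual"
proof (rule ringI[OF _ monoid_dual_algebra])
  show "abelian_group dual"
  proof (rule abelian_groupI, goal_cases)
    case (6 f)
    then have "functional f" by (simp add: dual_algebra_def)
    then have "functional (\<lambda>x. - 1 * f x)" by (rule functional_mult)
    then show ?case by (intro bexI[of _ "\<lambda>x. - 1 * f x"]) (auto simp: dual_algebra_def)
  qed (auto simp: dual_algebra_def functional_add functional_zero ac_simps)
next
  fix f g h assume *: "f \<in> carrier dual" "g \<in> carrier dual"
    "h \<in> carrier dual"
  then have l: "functional f" "functional g" "functional h" by (auto simp: dual_algebra_def)
  show "(f \<oplus>\<^bsub>dual\<^esub> g) \<otimes>\<^bsub>dual\<^esub> h =
      f \<otimes>\<^bsub>dual\<^esub> h \<oplus>\<^bsub>dual\<^esub> g \<otimes>\<^bsub>dual\<^esub> h"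
    by (simp add: dual_algebra_def fun_eq_iff convolution_lhit[OF functional_add[OF l(1,2)]]
        convolution_lhit[OF l(1)] convolution_lhit[OF l(2)])
  show "h \<otimes>\<^bsub>dual\<^esub> (f \<oplus>\<^bsub>dual\<^esub> g) =
      h \<otimes>\<^bsub>dual\<^esub> f \<oplus>\<^bsub>dual\<^esub> h \<otimes>\<^bsub>dual\<^esub> g"
    by (simp add: dual_algebra_def fun_eq_iff convolution_rhit[OF functional_add[OF l(1,2)]]
        convolution_rhit[OF l(1)] convolution_rhit[OF l(2)])
qed

end

section \<open>Chain coalgebras of infinite dimension\<close>

locale infinite_chain_coalgebra = chain_coalgebra +
  assumes infinite_dim: "\<not> finite_dim scale UNIV"
begin

text \<open>A proper right coideal does not contain the orbit of an element outside it, so it is contained in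
  that orbit.\<close>

lemma finite_dim_if_proper:
  assumes V: "right_coideal V" "V \<noteq> UNIV"
  shows "finite_dim scale V"
proof -
  obtain x where "x \<notin> V" using V(2) by blast
  then have "\<not> orbit x \<subseteq> V" using mem_orbit by blast
  then have "V \<subseteq> orbit x"
    using right_coideals_chain[OF V(1) right_coideal_orbit] by blast
  then show ?thesis using finite_dim_orbit finite_dim_subset by blast
qed

text \<open>A subspace stable under the left action is also stable under the right action: the image of an
  orbit is a right coideal of at most the same dimension, hence contained in the orbit.\<close>

lemma rhit_in_right_coideal:
  assumes f: "functional f" and V: "right_coideal V" and x: "x \<in> V"
  shows "x \<leftharpoonup> f \<in> V"
proof -
  let ?F = "\<lambda>x. x \<leftharpoonup> f"
  have "?F ` orbit x \<subseteq> orbit x"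
  proof (rule ccontr)
    assume n: "\<not> ?thesis"
    then have sub: "orbit x \<subseteq> ?F ` orbit x"
      using right_coideals_chain[OF right_coideal_rhit_image[OF f right_coideal_orbit]
          right_coideal_orbit] by blast
    have "orbit x = ?F ` orbit x"
      by (rule subspace_eq_if_dim_le[OF _ _ sub])
        (auto intro: right_coideal_subspace right_coideal_orbit finite_dim_image linear_rhit
          finite_dim_orbit f dim_image_le)
    with n show False by blast
  qed
  then show ?thesis using orbit_subset[OF V x] mem_orbit by blast
qed

text \<open>The kernel of a nonzero \<open>x \<mapsto> x \<leftharpoonup> f\<close> is proper.  Were the image proper too, both would have finite
  dimension, and so would \<open>C\<close>.\<close>

lemma surj_rhit:
  assumes f: "functional f" and "f \<noteq> (\<lambda>_. 0)"
  shows "surj (\<lambda>x. x \<leftharpoonup> f)"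
proof (rule ccontr)
  assume "\<not> ?thesis"
  then have "finite_dim scale (range (\<lambda>x. x \<leftharpoonup> f))"
    using right_coideal_rhit_image[OF f, of UNIV] right_coideal_iff_lhit finite_dim_if_proper by simp
  moreover obtain x where "f x \<noteq> 0" using assms(2) by blast
  then have "x \<leftharpoonup> f \<noteq> 0"
    by (auto simp: functional_eq_counit_rhit[OF f, of x] counit_zero)
  then have "{x. x \<leftharpoonup> f = 0} \<noteq> UNIV" by blast
  then have "finite_dim scale {x. x \<leftharpoonup> f = 0}"
    using right_coideal_rhit_kernel[OF f] finite_dim_if_proper by blast
  ultimately show False
    using finite_dim_if_kernel_range[OF linear_rhit[OF f]] infinite_dim by blast
qed

text \<open>Since \<open>(f \<star> g)(x) = g (x \<leftharpoonup> f)\<close>, multiplication by \<open>f\<close> on the left is dual to a surjective map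
  if \<open>f \<noteq> 0\<close>.\<close>

lemma convolution_eq_zeroD:
  assumes f: "functional f" and g: "functional g" and "f \<star> g = (\<lambda>_. 0)"
  shows "f = (\<lambda>_. 0) \<or> g = (\<lambda>_. 0)"
proof (cases "f = (\<lambda>_. 0)")
  case False
  have "g y = 0" for y
  proof -
    obtain x where "y = x \<leftharpoonup> f" using surj_rhit[OF f False] by blast
    then show ?thesis using assms(3) convolution_rhit[OF g, of f x] by simp
  qed
  then show ?thesis by blast
qed simp

text \<open>Among the right coideals of finite dimension not contained in \<open>W\<close> choose one of least dimension.
  Comparing it with the orbit of a point of \<open>U - W\<close> shows that every competitor \<open>U\<close> contains it.\<close>

lemma next_coideal:
  assumes W: "right_coideal W" "W \<noteq> UNIV"
  shows "right_coideal (next_coideal W)" "finite_dim scale (next_coideal W)"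
    "\<not> next_coideal W \<subseteq> W"
proof -
  let ?P = "\<lambda>V. right_coideal V \<and> finite_dim scale V \<and> \<not> V \<subseteq> W"
  obtain x where "x \<notin> W" using W(2) by blast
  then have "?P (orbit x)"
    using mem_orbit right_coideal_orbit finite_dim_orbit by blast
  then obtain V where V: "?P V" "\<And>U. ?P U \<Longrightarrow> dim V \<le> dim U"
    using ex_has_least_nat[of ?P _ dim] by blast
  have "V \<subseteq> U" if U: "right_coideal U" "\<not> U \<subseteq> W" for U
  proof -
    obtain y where y: "y \<in> U" "y \<notin> W" using U(2) by blast
    then have "?P (orbit y)"
      using mem_orbit right_coideal_orbit finite_dim_orbit by blast
    then have "dim V \<le> dim (orbit y)" by (rule V(2))
    then have "V \<subseteq> orbit y"
      using right_coideals_chain[of V "orbit y"] V(1) right_coideal_orbit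
        subspace_eq_if_dim_le[of "orbit y" V] right_coideal_subspace by blast
    then show ?thesis using orbit_subset[OF U(1) y(1)] by blast
  qed
  then have "next_coideal W = V"
    unfolding next_coideal_def using V(1) by blast
  then show "right_coideal (next_coideal W)" "finite_dim scale (next_coideal W)"
    "\<not> next_coideal W \<subseteq> W" using V(1) by auto
qed

definition socle :: "'b set" where "socle = next_coideal {0}"

lemma UNIV_not_zero: "{0} \<noteq> (UNIV :: 'b set)"
  using infinite_dim finite_dim_zero by metis

lemma socle: "right_coideal socle" "finite_dim scale socle" "\<not> socle \<subseteq> {0}"
  unfolding socle_def using next_coideal[OF right_coideal_zero UNIV_not_zero] by blast+

lemma socle_proper: "socle \<noteq> UNIV"
  using socle(2) infinite_dim by metis

lemma socle_subset: "right_coideal V \<Longrightarrow> \<not> V \<subseteq> {0} \<Longrightarrow> socle \<subseteq> V"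
  unfolding socle_def by (rule next_coideal_lower)

text \<open>The kernel of \<open>x \<mapsto> x \<leftharpoonup> f\<close> does not contain the socle, so it is zero, and the counit factors through
  this injective map.  The conclusion on the socle allows the lemma to be applied to \<open>g\<close> in turn.\<close>

lemma right_inverse_if_nonzero_on_socle:
  assumes f: "functional f" and nz: "\<exists>x\<in>socle. f x \<noteq> 0"
  shows "\<exists>g. functional g \<and> (\<exists>x\<in>socle. g x \<noteq> 0) \<and> f \<star> g = \<epsilon>"
proof -
  have "\<not> socle \<subseteq> {x. x \<leftharpoonup> f = 0}"
    using rhit_eq_zero_on_right_coideal_iff[OF f socle(1)] nz by auto
  then have inj: "x \<leftharpoonup> f = 0 \<Longrightarrow> x = 0" for x
    using socle_subset[OF right_coideal_rhit_kernel[OF f]] by blast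
  obtain g where g: "functional g" "\<And>x. \<epsilon> x = g (x \<leftharpoonup> f)"
    using functional_factors[OF linear_rhit[OF f] counit_linear] inj counit_zero by blast
  obtain c where c: "c \<in> socle" "\<epsilon> c \<noteq> 0"
    using rhit_eq_zero_on_right_coideal_iff[OF counit_linear socle(1)] socle(3)
    by (auto simp: counit_rhit)
  have "g (c \<leftharpoonup> f) \<noteq> 0" using c(2) g(2) by metis
  moreover have "c \<leftharpoonup> f \<in> socle" by (rule rhit_in_right_coideal[OF f socle(1) c(1)])
  moreover have "f \<star> g = \<epsilon>" by (rule ext) (simp add: convolution_rhit[OF g(1)] g(2))
  ultimately show ?thesis using g(1) by blast
qed

text \<open>The right inverse of \<open>f\<close> has itself a right inverse, which must then be \<open>f\<close>.\<close>

lemma invertible_if_nonzero_on_socle: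
  assumes f: "functional f" and nz: "\<exists>x\<in>socle. f x \<noteq> 0"
  shows "\<exists>g. functional g \<and> f \<star> g = \<epsilon> \<and> g \<star> f = \<epsilon>"
proof -
  obtain g where g: "functional g" "\<exists>x\<in>socle. g x \<noteq> 0" "f \<star> g = \<epsilon>"
    using right_inverse_if_nonzero_on_socle[OF f nz] by blast
  obtain h where h: "functional h" "g \<star> h = \<epsilon>"
    using right_inverse_if_nonzero_on_socle[OF g(1,2)] by blast
  have "f = f \<star> (g \<star> h)" by (simp add: h counit_convolution f)
  also have "\<dots> = (f \<star> g) \<star> h" by (simp only: convolution_assoc f g(1) h(1))
  also have "\<dots> = h" by (simp add: g counit_convolution h)
  finally show ?thesis using g h by blast
qed

end

section \<open>Left ideals generated by powers of one element\<close>

lemma gen_left_ideal_eqI: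
  assumes "left_ideal I R" "S \<subseteq> I" "\<And>J. left_ideal J R \<Longrightarrow> S \<subseteq> J \<Longrightarrow> I \<subseteq> J"
  shows "I = gen_left_ideal R S"
  using assms by (auto simp: gen_left_ideal_def)

text \<open>If \<open>n\<close> is least with \<open>t [^] n\<close> in a nonzero left ideal \<open>I\<close>, then every element \<open>a \<otimes> t [^] k\<close> of
  \<open>I\<close> has \<open>k \<ge> n\<close>, so \<open>I\<close> is generated by \<open>t [^] n\<close>; left ideals are then compared by their
  exponents.\<close>

lemma left_noetherian_chain_domainI:
  fixes R (structure)
  assumes "ring R" and one: "\<one> \<noteq> \<zero>"
    and zd: "\<And>a b. a \<in> carrier R \<Longrightarrow> b \<in> carrier R \<Longrightarrow> a \<otimes> b = \<zero> \<Longrightarrow> a = \<zero> \<or> b = \<zero>"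
    and t: "t \<in> carrier R"
    and fac: "\<forall>x\<in>carrier R. x \<noteq> \<zero> \<longrightarrow> (\<exists>n::nat. \<exists>a\<in>Units R. x = a \<otimes> t [^] n)"
  shows "left_noetherian_chain_domain R"
proof -
  interpret ring R by fact
  have sub: "I \<subseteq> carrier R" if "left_ideal I R" for I
    using that additive_subgroup.a_subset by (auto simp: left_ideal_def)
  have zero: "\<zero> \<in> I" if "left_ideal I R" for I
    using that additive_subgroup.zero_closed by (auto simp: left_ideal_def)
  have mult: "a \<otimes> x \<in> I" if "left_ideal I R" "a \<in> carrier R" "x \<in> I" for I a x
    using that by (auto simp: left_ideal_def)
  have pow: "t [^] n \<in> I" if I: "left_ideal I R" and a: "a \<in> Units R" and "a \<otimes> t [^] n \<in> I"
    for I a and n :: nat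
  proof -
    have "inv a \<otimes> (a \<otimes> t [^] n) \<in> I" by (rule mult) (use that in auto)
    moreover have "inv a \<otimes> (a \<otimes> t [^] n) = t [^] n"
      using a t by (simp add: m_assoc[symmetric] Units_closed)
    ultimately show ?thesis by simp
  qed
  have pow_le: "t [^] m \<in> I" if I: "left_ideal I R" and "t [^] n \<in> I" "n \<le> m" for I and m n :: nat
  proof -
    have "t [^] m = t [^] (m - n) \<otimes> t [^] n" using t \<open>n \<le> m\<close> by (simp add: nat_pow_mult)
    then show ?thesis using mult[OF I _ that(2), of "t [^] (m - n)"] t by simp
  qed
  have principal: "\<exists>n::nat. t [^] n \<in> I \<and> (\<forall>J. left_ideal J R \<longrightarrow> t [^] n \<in> J \<longrightarrow> I \<subseteq> J)"
    if I: "left_ideal I R" and nz: "I \<noteq> {\<zero>}" for I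
  proof -
    obtain x where x: "x \<in> I" "x \<noteq> \<zero>" using nz zero[OF I] by blast
    define n where "n = (LEAST n::nat. t [^] n \<in> I)"
    obtain m :: nat where m: "t [^] m \<in> I"
      using fac x sub[OF I] pow[OF I] by blast
    then have n: "t [^] n \<in> I" unfolding n_def by (rule LeastI)
    moreover have "I \<subseteq> J" if J: "left_ideal J R" "t [^] n \<in> J" for J
    proof
      fix y assume y: "y \<in> I"
      show "y \<in> J"
      proof (cases "y = \<zero>")
        case False
        then obtain a and k :: nat where a: "a \<in> Units R" "y = a \<otimes> t [^] k"
          using fac y sub[OF I] by blast
        then have "t [^] k \<in> I" using pow[OF I] y by blast
        then have "n \<le> k" unfolding n_def by (rule Least_le)
        then have "t [^] k \<in> J" by (rule pow_le[OF J])
        then show ?thesis using a mult[OF J(1)] by auto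
      qed (use zero J in blast)
    qed
    ultimately show ?thesis by blast
  qed
  show ?thesis
  proof unfold_locales
    show "\<one> \<noteq> \<zero>" by (rule one)
    show "a = \<zero> \<or> b = \<zero>" if "a \<in> carrier R" "b \<in> carrier R" "a \<otimes> b = \<zero>" for a b
      using that by (rule zd)
    show "\<exists>S\<subseteq>carrier R. finite S \<and> I = gen_left_ideal R S" if I: "left_ideal I R" for I
    proof (cases "I = {\<zero>}")
      case True
      have "I = gen_left_ideal R {}"
        by (rule gen_left_ideal_eqI[OF I]) (use True zero in auto)
      then show ?thesis by blast
    next
      case False
      then obtain n :: nat where n: "t [^] n \<in> I" "\<forall>J. left_ideal J R \<longrightarrow> t [^] n \<in> J \<longrightarrow> I \<subseteq> J"
        using principal[OF I] by blast
      have "I = gen_left_ideal R {t [^] n}"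
        by (rule gen_left_ideal_eqI[OF I]) (use n in auto)
      then show ?thesis using t by (intro exI[of _ "{t [^] n}"]) auto
    qed
    show "I \<subseteq> J \<or> J \<subseteq> I" if I: "left_ideal I R" and J: "left_ideal J R" for I J
    proof (cases "I = {\<zero>} \<or> J = {\<zero>}")
      case True
      then show ?thesis using zero[OF I] zero[OF J] by blast
    next
      case False
      obtain m :: nat where m: "t [^] m \<in> I" "\<forall>K. left_ideal K R \<longrightarrow> t [^] m \<in> K \<longrightarrow> I \<subseteq> K"
        using principal[OF I] False by blast
      obtain n :: nat where n: "t [^] n \<in> J" "\<forall>K. left_ideal K R \<longrightarrow> t [^] n \<in> K \<longrightarrow> J \<subseteq> K"
        using principal[OF J] False by blast
      show ?thesis using nat_le_linear[of m n] pow_le[OF I m(1), of n] pow_le[OF J n(1), of m] m(2) n(2) I J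
        by blast
    qed
  qed
qed

section \<open>Dividing by a uniformizer\<close>

text \<open>The functional \<open>t\<close> generates the maximal ideal of the dual algebra, the annihilator of the socle,
  because it lies outside the square of that ideal.\<close>

locale chain_coalgebra_with_uniformizer = infinite_chain_coalgebra +
  fixes t
  assumes t_functional: "functional t"
    and t_socle: "x \<in> socle \<Longrightarrow> t x = 0"
    and t_next: "\<exists>x\<in>next_coideal socle. t x \<noteq> 0"
begin

interpretation L: Vector_Spaces.linear scale scale "\<lambda>x. x \<leftharpoonup> t"
  by (rule linear_rhit[OF t_functional])

interpretation R: Vector_Spaces.linear scale scale "\<lambda>x. t \<rightharpoonup> x"
  by (rule linear_lhit[OF t_functional])

text \<open>The kernel is a right coideal; if it were larger than the socle it would contain the next coideal,
  on which \<open>t\<close> does not vanish.\<close>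

lemma rhit_t_eq_0_iff: "x \<leftharpoonup> t = 0 \<longleftrightarrow> x \<in> socle"
proof -
  have "{x. x \<leftharpoonup> t = 0} \<subseteq> socle"
  proof (rule ccontr)
    assume "\<not> ?thesis"
    then have "next_coideal socle \<subseteq> {x. x \<leftharpoonup> t = 0}"
      by (rule next_coideal_lower[OF right_coideal_rhit_kernel[OF t_functional]])
    then show False
      using rhit_eq_zero_on_right_coideal_iff[OF t_functional next_coideal(1)[OF socle(1) socle_proper]]
        t_next by blast
  qed
  moreover have "\<forall>x\<in>socle. x \<leftharpoonup> t = 0"
    using rhit_eq_zero_on_right_coideal_iff[OF t_functional socle(1)] t_socle by blast
  ultimately show ?thesis by blast
qed

lemma lhit_t_socle: "x \<in> socle \<Longrightarrow> t \<rightharpoonup> x = 0"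
proof (rule functional_eq_zero)
  fix h assume h: "functional h" and x: "x \<in> socle"
  have "h (t \<rightharpoonup> x) = t (x \<leftharpoonup> h)"
    by (simp add: convolution_lhit[OF h, symmetric] convolution_rhit[OF t_functional])
  then show "h (t \<rightharpoonup> x) = 0"
    using t_socle rhit_in_right_coideal[OF h socle(1) x] by simp
qed

lemma surj_rhit_t: "surj (\<lambda>x. x \<leftharpoonup> t)"
  using surj_rhit[OF t_functional] t_next by (metis)

text \<open>The preimage of the socle contains the next coideal, and the image of the next coideal is
  nonzero, so it contains the socle.\<close>

lemma rhit_t_next: "(\<lambda>x. x \<leftharpoonup> t) ` next_coideal socle = socle"
proof
  note next_coideal = next_coideal[OF socle(1) socle_proper]
  obtain c where c: "c \<in> socle" "c \<noteq> 0" using socle(3) by blast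
  obtain y where y: "c = y \<leftharpoonup> t" using surj_rhit_t by blast
  have "\<not> {x. x \<leftharpoonup> t \<in> socle} \<subseteq> socle"
    using c y rhit_t_eq_0_iff by blast
  then have "next_coideal socle \<subseteq> {x. x \<leftharpoonup> t \<in> socle}"
    by (rule next_coideal_lower[OF right_coideal_rhit_vimage[OF t_functional socle(1)]])
  then show "(\<lambda>x. x \<leftharpoonup> t) ` next_coideal socle \<subseteq> socle" by blast
  show "socle \<subseteq> (\<lambda>x. x \<leftharpoonup> t) ` next_coideal socle"
    by (rule socle_subset[OF right_coideal_rhit_image[OF t_functional next_coideal(1)]])
      (use next_coideal(3) rhit_t_eq_0_iff in blast)
qed

text \<open>The image lies in the kernel of \<open>x \<mapsto> x \<leftharpoonup> t\<close>, the socle.  It is all of it: a functional \<open>f\<close> that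
  vanishes on the image but not on the socle is invertible, while \<open>f \<star> t\<close> vanishes on the next
  coideal, so \<open>t\<close> would vanish there as well.\<close>

lemma lhit_t_next: "(\<lambda>x. t \<rightharpoonup> x) ` next_coideal socle = socle"
proof
  note next_coideal = next_coideal[OF socle(1) socle_proper]
  let ?W = "(\<lambda>x. t \<rightharpoonup> x) ` next_coideal socle"
  show sub: "?W \<subseteq> socle"
  proof clarify
    fix x assume x: "x \<in> next_coideal socle"
    have "(t \<rightharpoonup> x) \<leftharpoonup> t = t \<rightharpoonup> (x \<leftharpoonup> t)"
      by (simp add: lhit_rhit_commute t_functional)
    also have "\<dots> = 0" by (rule lhit_t_socle) (use x rhit_t_next in blast)
    finally show "t \<rightharpoonup> x \<in> socle" by (simp add: rhit_t_eq_0_iff)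
  qed
  show "socle \<subseteq> ?W"
  proof (rule ccontr)
    assume "\<not> ?thesis"
    then obtain c where c: "c \<in> socle" "c \<notin> ?W" by blast
    have "subspace ?W" by (rule R.subspace_image) (rule right_coideal_subspace[OF next_coideal(1)])
    then obtain f where f: "functional f" "\<And>x. x \<in> ?W \<Longrightarrow> f x = 0" "f c = 1"
      using functional_separating c(2) by blast
    have "\<exists>x\<in>socle. f x \<noteq> 0" using c(1) f(3) by (intro bexI[of _ c]) auto
    then obtain g where g: "functional g" "g \<star> f = \<epsilon>"
      using invertible_if_nonzero_on_socle[OF f(1)] by blast
    have "t x = 0" if x: "x \<in> next_coideal socle" for x
    proof -
      have "t x = ((g \<star> f) \<star> t) x" by (simp add: g counit_convolution t_functional)
      also have "\<dots> = (g \<star> (f \<star> t)) x" by (simp only: convolution_assoc f g(1) t_functional)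
      also have "\<dots> = f (t \<rightharpoonup> (x \<leftharpoonup> g))"
        by (simp add: convolution_rhit[OF functional_convolution[OF f(1) t_functional]]
            convolution_lhit[OF f(1)])
      also have "\<dots> = 0"
        by (rule f(2)) (rule imageI[OF rhit_in_right_coideal[OF g(1) next_coideal(1) x]])
      finally show ?thesis .
    qed
    then show False using t_next by blast
  qed
qed

text \<open>The two maps \<open>x \<mapsto> x \<leftharpoonup> t\<close> and \<open>x \<mapsto> t \<rightharpoonup> x\<close> differ by a linear map \<open>\<psi>\<close>, which is dual to the
  twist \<open>\<sigma>\<close> in \<open>a \<star> t = t \<star> \<sigma>(a)\<close>.  Both map the next coideal onto the socle, so \<open>\<psi>\<close> maps the socle
  onto itself; by finite dimension it is injective there.\<close>

lemma twist:
  obtains \<psi> where "\<And>x. \<psi> (x \<leftharpoonup> t) = t \<rightharpoonup> x" "\<And>y. y \<in> socle \<Longrightarrow> \<psi> y = 0 \<Longrightarrow> y = 0"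
proof -
  obtain s where s: "Vector_Spaces.linear scale scale s" "\<And>x. s (x \<leftharpoonup> t) \<leftharpoonup> t = x \<leftharpoonup> t"
    using linear_section[OF linear_rhit[OF t_functional]] by blast
  define \<psi> where "\<psi> y = t \<rightharpoonup> s y" for y
  have lin: "Vector_Spaces.linear scale scale \<psi>"
    using Vector_Spaces.linear_compose[OF s(1) linear_lhit[OF t_functional]]
    by (simp add: \<psi>_def[abs_def] o_def)
  have \<psi>: "\<psi> (x \<leftharpoonup> t) = t \<rightharpoonup> x" for x
  proof -
    have "s (x \<leftharpoonup> t) - x \<in> socle" by (simp add: rhit_t_eq_0_iff[symmetric] L.diff s(2))
    then have "t \<rightharpoonup> (s (x \<leftharpoonup> t) - x) = 0" by (rule lhit_t_socle)
    then show ?thesis by (simp add: R.diff \<psi>_def)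
  qed
  have "\<psi> ` socle = socle"
  proof -
    have "\<psi> ` ((\<lambda>x. x \<leftharpoonup> t) ` next_coideal socle) = (\<lambda>x. t \<rightharpoonup> x) ` next_coideal socle"
      by (simp add: image_image \<psi>)
    then show ?thesis by (simp add: rhit_t_next lhit_t_next)
  qed
  then have "y = 0" if "y \<in> socle" "\<psi> y = 0" for y
    by (intro inj_if_dim_image_ge[OF lin socle(2) _ that]) simp
  with \<psi> show ?thesis by (rule that)
qed

text \<open>Unless \<open>V = {0}\<close>, it contains the socle, on which \<open>x \<mapsto> x \<leftharpoonup> t\<close> vanishes; hence the image of \<open>V\<close>,
  again a right coideal, has smaller dimension.\<close>

lemma nilpotent_rhit_t:
  assumes "right_coideal V" "finite_dim scale V"
  shows "\<exists>n. \<forall>x\<in>V. ((\<lambda>x. x \<leftharpoonup> t) ^^ n) x = 0"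
  using assms
proof (induction "dim V" arbitrary: V rule: less_induct)
  case less
  let ?L = "\<lambda>x. x \<leftharpoonup> t"
  show ?case
  proof (cases "V \<subseteq> {0}")
    case True
    then show ?thesis by (intro exI[of _ 0]) auto
  next
    case False
    then have sub: "socle \<subseteq> V" using less.prems(1) socle_subset by blast
    obtain c where c: "c \<in> socle" "c \<noteq> 0" using socle(3) by blast
    have "dim (?L ` V) < dim V"
    proof (rule ccontr)
      assume "\<not> ?thesis"
      then have "c = 0"
        using sub c(1) rhit_t_eq_0_iff inj_if_dim_image_ge[OF L.linear_axioms less.prems(2)]
        by (meson leI subsetD)
      with c show False by simp
    qed
    then obtain n where "\<forall>x\<in>?L ` V. (?L ^^ n) x = 0"
      using less.hyps right_coideal_rhit_image[OF t_functional less.prems(1)]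
        finite_dim_image[OF L.linear_axioms less.prems(2)] by blast
    then have "\<forall>x\<in>V. (?L ^^ Suc n) x = 0" by (simp add: funpow_Suc_right del: funpow.simps)
    then show ?thesis by blast
  qed
qed

lemma locally_nilpotent_rhit_t: "\<exists>n. ((\<lambda>x. x \<leftharpoonup> t) ^^ n) x = 0"
  using nilpotent_rhit_t[OF right_coideal_orbit finite_dim_orbit] mem_orbit by blast

lemma funpow_rhit_lhit_commute:
  "((\<lambda>x. x \<leftharpoonup> t) ^^ n) (t \<rightharpoonup> x) = t \<rightharpoonup> (((\<lambda>x. x \<leftharpoonup> t) ^^ n) x)"
  by (induction n) (simp_all add: lhit_rhit_commute t_functional)

text \<open>By induction on a power of \<open>x \<mapsto> x \<leftharpoonup> t\<close> that kills \<open>x\<close>: the actions commute, so the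
  hypothesis passes from \<open>x\<close> to \<open>x \<leftharpoonup> t\<close>, which puts \<open>x \<leftharpoonup> t\<close> in the socle, where \<open>\<psi>\<close> is injective.\<close>

lemma lhit_t_eq_0_imp_socle:
  assumes "t \<rightharpoonup> x = 0"
  shows "x \<in> socle"
proof -
  obtain \<psi> where \<psi>: "\<And>x. \<psi> (x \<leftharpoonup> t) = t \<rightharpoonup> x" "\<And>y. y \<in> socle \<Longrightarrow> \<psi> y = 0 \<Longrightarrow> y = 0"
    using twist by blast
  obtain n where "((\<lambda>x. x \<leftharpoonup> t) ^^ n) x = 0" using locally_nilpotent_rhit_t by blast
  then have "x \<leftharpoonup> t = 0" using assms
  proof (induction n arbitrary: x)
    case 0
    then show ?case by simp
  next
    case (Suc n)
    have "((\<lambda>x. x \<leftharpoonup> t) ^^ n) (x \<leftharpoonup> t) = 0"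
      using Suc.prems(1) by (simp add: funpow_Suc_right del: funpow.simps)
    moreover have "t \<rightharpoonup> (x \<leftharpoonup> t) = 0"
      by (simp add: lhit_rhit_commute t_functional Suc.prems(2))
    ultimately have "(x \<leftharpoonup> t) \<leftharpoonup> t = 0" by (rule Suc.IH)
    then have "x \<leftharpoonup> t \<in> socle" by (simp only: rhit_t_eq_0_iff)
    then show ?case by (rule \<psi>(2)) (simp add: \<psi>(1) Suc.prems(2))
  qed
  then show ?thesis by (simp add: rhit_t_eq_0_iff)
qed

text \<open>If \<open>n + 1\<close> right actions of \<open>t\<close> kill \<open>x\<close>, then \<open>n\<close> of them move \<open>x\<close> into the socle, where the left
  action of \<open>t\<close> vanishes; so each right action can be traded for a left one.\<close>

lemma locally_nilpotent_lhit_t: "\<exists>n. ((\<lambda>x. t \<rightharpoonup> x) ^^ n) x = 0"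
proof -
  obtain n where "((\<lambda>x. x \<leftharpoonup> t) ^^ n) x = 0" using locally_nilpotent_rhit_t by blast
  then have "((\<lambda>x. t \<rightharpoonup> x) ^^ n) x = 0"
  proof (induction n arbitrary: x)
    case 0
    then show ?case by simp
  next
    case (Suc n)
    have "((\<lambda>x. x \<leftharpoonup> t) ^^ n) x \<in> socle"
      using Suc.prems by (simp add: rhit_t_eq_0_iff)
    then have "((\<lambda>x. x \<leftharpoonup> t) ^^ n) (t \<rightharpoonup> x) = 0"
      by (simp add: funpow_rhit_lhit_commute lhit_t_socle)
    then have "((\<lambda>x. t \<rightharpoonup> x) ^^ n) (t \<rightharpoonup> x) = 0" by (rule Suc.IH)
    then show ?case by (simp add: funpow_Suc_right del: funpow.simps)
  qed
  then show ?thesis ..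
qed

text \<open>Induction on the number of left actions of \<open>t\<close> that kill a point where \<open>f\<close> is nonzero.  If \<open>f\<close>
  vanishes on the socle, the kernel of \<open>x \<mapsto> t \<rightharpoonup> x\<close>, then \<open>f = g \<star> t\<close>, and \<open>g\<close> is nonzero at
  \<open>t \<rightharpoonup> x\<close>, which needs one action less.\<close>

lemma factorization:
  assumes f: "functional f" and "f \<noteq> (\<lambda>_. 0)"
  shows "\<exists>n::nat. \<exists>a\<in>Units dual. f = a \<otimes>\<^bsub>dual\<^esub> t [^]\<^bsub>dual\<^esub> n"
proof -
  interpret A: ring dual by (rule ring_dual_algebra)
  obtain x where x: "f x \<noteq> 0" using assms(2) by blast
  obtain n where "((\<lambda>x. t \<rightharpoonup> x) ^^ n) x = 0" using locally_nilpotent_lhit_t by blast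
  with f x show ?thesis
  proof (induction n arbitrary: f x)
    case 0
    then show ?case by (simp add: module_hom.zero[OF Vector_Spaces.linear.axioms(3)])
  next
    case (Suc n)
    have fA: "f \<in> carrier dual" using Suc.prems(1) by (simp add: dual_algebra_def)
    show ?case
    proof (cases "\<exists>x\<in>socle. f x \<noteq> 0")
      case True
      then obtain g where g: "functional g" "f \<star> g = \<epsilon>" "g \<star> f = \<epsilon>"
        using invertible_if_nonzero_on_socle[OF Suc.prems(1)] by blast
      have "f \<in> Units dual" unfolding Units_def using g Suc.prems(1) by (auto simp: dual_algebra_def)
      moreover have "f = f \<otimes>\<^bsub>dual\<^esub> t [^]\<^bsub>dual\<^esub> (0::nat)" using fA by simp
      ultimately show ?thesis by blast
    next
      case False
      then obtain g where g: "functional g" "\<And>x. f x = g (t \<rightharpoonup> x)"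
        using functional_factors[OF linear_lhit[OF t_functional] Suc.prems(1)] lhit_t_eq_0_imp_socle
        by blast
      have "\<exists>n::nat. \<exists>a\<in>Units dual. g = a \<otimes>\<^bsub>dual\<^esub> t [^]\<^bsub>dual\<^esub> n"
        by (rule Suc.IH[OF g(1)])
          (use Suc.prems(2,3) in \<open>simp_all add: g(2) funpow_Suc_right del: funpow.simps\<close>)
      then obtain m :: nat and a where a: "a \<in> Units dual" "g = a \<otimes>\<^bsub>dual\<^esub> t [^]\<^bsub>dual\<^esub> m" by blast
      have "f = g \<star> t" by (rule ext) (simp add: g(2) convolution_lhit[OF g(1)])
      then have "f = g \<otimes>\<^bsub>dual\<^esub> t" by (simp add: dual_algebra_def)
      also have "\<dots> = a \<otimes>\<^bsub>dual\<^esub> t [^]\<^bsub>dual\<^esub> Suc m"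
      proof -
        have "t \<in> carrier dual" using t_functional by (simp add: dual_algebra_def)
        then show ?thesis using a by (simp add: A.m_assoc A.Units_closed)
      qed
      finally show ?thesis using a(1) by blast
    qed
  qed
qed

end

lemma (in infinite_chain_coalgebra) exists_uniformizer:
  "\<exists>t. chain_coalgebra_with_uniformizer scale \<Delta> \<epsilon> t"
proof -
  obtain x where x: "x \<in> next_coideal socle" "x \<notin> socle"
    using next_coideal(3)[OF socle(1) socle_proper] by blast
  obtain t where t: "functional t" "\<And>v. v \<in> socle \<Longrightarrow> t v = 0" "t x = 1"
    using functional_separating[OF right_coideal_subspace[OF socle(1)] x(2)] by blast
  have "chain_coalgebra_with_uniformizer scale \<Delta> \<epsilon> t"
    by (intro chain_coalgebra_with_uniformizer.intro infinite_chain_coalgebra_axioms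
        chain_coalgebra_with_uniformizer_axioms.intro)
      (use t x in \<open>auto intro!: bexI[of _ x]\<close>)
  then show ?thesis by blast
qed

theorem theorem5p2:
  fixes scale :: "'k::field \<Rightarrow> 'c::ab_group_add \<Rightarrow> 'c"
    and \<Delta> :: "'c \<Rightarrow> ('c \<times> 'c \<Rightarrow>\<^sub>0 'k) set"
    and \<epsilon> :: "'c \<Rightarrow> 'k"
    and A :: "('c \<Rightarrow> 'k) ring"
  assumes "chain_coalgebra scale \<Delta> \<epsilon>"
    and "\<not> (\<exists>B. finite B \<and> module.span scale B = UNIV)"
    and "A = dual_algebra scale \<Delta> \<epsilon>"
  shows "(\<exists>t\<in>carrier A. \<forall>x\<in>carrier A. x \<noteq> \<zero>\<^bsub>A\<^esub> \<longrightarrow>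
            (\<exists>n::nat. \<exists>a\<in>Units A. x = a \<otimes>\<^bsub>A\<^esub> t [^]\<^bsub>A\<^esub> n)) \<and>
         left_noetherian_chain_domain A"
proof -
  interpret C: chain_coalgebra scale \<Delta> \<epsilon> by fact
  interpret C: infinite_chain_coalgebra scale \<Delta> \<epsilon>
    by unfold_locales (use assms(2) in \<open>auto simp: finite_dim_def\<close>)
  obtain t where "chain_coalgebra_with_uniformizer scale \<Delta> \<epsilon> t"
    using C.exists_uniformizer by blast
  then interpret chain_coalgebra_with_uniformizer scale \<Delta> \<epsilon> t .
  have A: "carrier A = {f. C.functional f}" "\<zero>\<^bsub>A\<^esub> = (\<lambda>_. 0)" "\<one>\<^bsub>A\<^esub> = \<epsilon>"
      "\<And>f g. f \<otimes>\<^bsub>A\<^esub> g = convolution \<Delta> f g"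
    by (simp_all add: assms(3) dual_algebra_def)
  have fac: "\<forall>x\<in>carrier A. x \<noteq> \<zero>\<^bsub>A\<^esub> \<longrightarrow> (\<exists>n::nat. \<exists>a\<in>Units A. x = a \<otimes>\<^bsub>A\<^esub> t [^]\<^bsub>A\<^esub> n)"
    using factorization A(1,2) assms(3) by simp
  have t: "t \<in> carrier A" using t_functional A(1) by simp
  obtain x where "t x \<noteq> 0" using t_next by blast
  then have "x \<noteq> 0" by (auto simp: module_hom.zero[OF Vector_Spaces.linear.axioms(3)[OF t_functional]])
  have "\<epsilon> \<noteq> (\<lambda>_. 0)"
  proof
    assume "\<epsilon> = (\<lambda>_. 0)"
    then have "x = 0" using C.counit_lhit[of x] C.lhit_zero_left[of x] by simp
    with \<open>x \<noteq> 0\<close> show False ..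
  qed
  have "left_noetherian_chain_domain A"
  proof (rule left_noetherian_chain_domainI[OF _ _ _ t fac])
    show "ring A" unfolding assms(3) by (rule C.ring_dual_algebra)
    show "\<one>\<^bsub>A\<^esub> \<noteq> \<zero>\<^bsub>A\<^esub>" using \<open>\<epsilon> \<noteq> _\<close> by (simp add: A)
    show "f = \<zero>\<^bsub>A\<^esub> \<or> g = \<zero>\<^bsub>A\<^esub>"
      if "f \<in> carrier A" "g \<in> carrier A" "f \<otimes>\<^bsub>A\<^esub> g = \<zero>\<^bsub>A\<^esub>" for f g
      using that C.convolution_eq_zeroD by (simp add: A)
  qed
  with fac t show ?thesis by blast
qed

end
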